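(* Let $T$ be a complete open $\mathcal{L}$-theory of topological fields of characteristic $0$ that satisfies $(\dagger)_{large}$, where the relation symbols of $\mathcal{L}$ satisfy $(\dagger)$. Assume that $T$ admits quantifier elimination in $\mathcal{L}$. Let $\tilde T$ be a complete theory of Boolean algebras and let $\mathcal{A}$ be a model of $\Gamma^e_{\tilde T}(T^*_\delta)$, with subring of constants $C_{\mathcal{A}}=\{a\in A:\delta(a)=0\}$. Then $(\mathcal{A},C_{\mathcal{A}})$ is a dense pair of models of $\Gamma^e_{\tilde T}(T)$, and hence an elementary pair, i.e. $C_{\mathcal{A}}\preceq\mathcal{A}$ as $\mathcal{L}$-structures.
   Context: Open theories. $\mathcal{L}$ is an expansion, by relation symbols and constants only, of the language of fields $\{+,-,\cdot,{}^{-1},0,1\}$ (with $0^{-1}=0$). A complete $\mathcal{L}$-theory $T$ of fields of characteristic $0$ is an open theory of topological fields if there is an $\mathcal{L}$-formula $\chi(x,z)$ such that in each $K\models T$ the sets $\chi(K,b)$ containing $0$ ($b$ a tuple of $K$) form a basis of neighbourhoods of $0$ of a non-discrete Hausdorff field topology, and every definable subset of $K^n$ is a finite union of sets $Z\cap U$ with $Z$ Zariski closed and $U$ definable and open. In models of $T$, model-theoretic algebraic closure $\mathrm{acl}$ coincides with field-theoretic relative algebraic closure (over the constants). $(\dagger)$: for each relation symbol $r(\bar x)$ of $\mathcal{L}$ there is a positive existential $\mathcal{L}$-formula equivalent to $\neg r(\bar x)$ modulo $T$. $(\dagger)_{large}$: every model $\mathcal{K}$ of $T$ has an elementary extension equipped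 with a henselian valuation whose topology coincides with the definable topology. $T_\delta$ is the theory, in $\mathcal{L}_\delta=\mathcal{L}\cup\{\delta\}$, of models of $T$ with a derivation $\delta$. $T^*_\delta$ is $T_\delta$ together with the scheme (DL): for every differential polynomial $q(y)$ over $K$ in one variable, of order $m\ge1$, with separant $s_q=\partial q/\partial\delta^m(y)$ and associated ordinary polynomials $q^*,s_q^*$ in $y_0,\dots,y_m$, for every $\bar a\in K^{m+1}$ with $q^*(\bar a)=0\neq s_q^*(\bar a)$ and every neighbourhood $W$ of $\bar a$, there is $b\in K$ with $q(b)=0\ne s_q(b)$ and $(b,\delta(b),\dots,\delta^m(b))\in W$. Boolean products. A subdirect product $\mathcal{A}=\prod^s_{x\in X}\mathcal{A}_x$ is a substructure of $\prod_{x\in X}\mathcal{A}_x$ projecting onto each factor. $[\varphi(\bar f)]=\{x\in X:\mathcal{A}_x\models\varphi(\bar f(x))\}$. A Boolean space is a totally disconnected compact Hausdorff space. For a theory $T_0$ in a language $\mathcal{L}'$, $\Gamma^e_{\tilde T}(T_0)$ is the class (and its theory) of all subdirect products with $\mathcal{A}_x\models T_0$, $X=\mathcal{X}(\mathcal{A})$ a Boolean space whose algebra of clopen sets $\mathcal{X}(\mathcal{A})^*$ is a model of $\tilde T$, such that (i) (patchwork) for all $f,g\in A$ and clopen $U$ there is $h\in A$ with $U\subseteq[f=h]$, $X\setminus U\subseteq[g=h]$; (ii) $[\varphi(\bar f)]$ is clopen for every $\mathcal{L}'$-formula $\varphi$ and tuple $\bar f$ from $A$. Models are taken represented as such products. Topology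 on $\mathcal{A}\models\Gamma^e(T)$. Let $p$ be the binary function given coordinatewise by $p(a,b)=a$ if $b=0$ and $p(a,b)=0$ otherwise, and $\mathcal{L}_p=\mathcal{L}\cup\{p\}$. It is assumed that $\chi$ is equivalent to a positive primitive existential $\mathcal{L}_p$-formula $\chi_p$ such that $\mathcal{A}\models\chi_p(a,b)$ iff $[\chi(a,b)]=X$. Basic neighbourhoods of $0$ in $A$ are the sets $\chi_p(A,b)$ with $\chi_p(0,b)$ true; basic neighbourhoods of $r$ are their translates by $r$. Dense pairs of boolean products. Let $\mathcal{A}\models\Gamma^e(T)$, $X=X(\mathcal{A})$, and let $\mathcal{D}$ be an $\mathcal{L}$-substructure. Let $\mathcal{D}_x\subseteq\mathcal{A}_x$ be the substructure with domain $\{d(x):d\in D\}$, so $\mathcal{D}=\prod^s_{x\in X}\mathcal{D}_x$, and $[\varphi(\bar f)]^{\mathcal{D}}=\{x\in X:\mathcal{D}_x\models\varphi(\bar f(x))\}$ for $\bar f$ from $D$. $\mathcal{D}$ is $\mathrm{acl}$-closed in $\mathcal{A}$ if each $\mathcal{D}_x$ is $\mathrm{acl}$-closed in $\mathcal{A}_x$. We say $\mathcal{D}\models\Gamma^e(T)$ with respect to $\mathcal{X}(\mathcal{D})^*$ if every $[\varphi(\bar f)]^{\mathcal{D}}$ ($\varphi$ an $\mathcal{L}$-formula, $\bar f$ from $D$) is in $\mathcal{X}(\mathcal{A})^*$, in which case $\mathcal{X}(\mathcal{D})^*$ denotes the Boolean subalgebra of all these sets, and the patchwork property holds in $\mathcal{D}$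 for $U\in\mathcal{X}(\mathcal{D})^*$. Then $(\mathcal{A},\mathcal{D})$ is a dense pair if moreover: (D1) $\mathcal{X}(\mathcal{D})^*\preceq\mathcal{X}(\mathcal{A})^*$; (D2) $\mathcal{D}$ is $\mathrm{acl}$-closed in $\mathcal{A}$; (D3) $(r+\chi_p(A,b))\cap D\neq\emptyset$ for all $r\in A$ and all tuples $b$ of $A$ with $\chi_p(0,b)$ true; (D4) for all $x\in X$ and $e\in\mathcal{X}(\mathcal{A})^*$ with $x\in e$ there is $\tilde e\in\mathcal{X}(\mathcal{D})^*$ with $x\in\tilde e\subseteq e$.
   Formalization: Added assumption: δ(c)=0 for every constant symbol c of L, i.e. the L-constants lie in C_A; otherwise C_A is not an L-substructure (e.g. a constant symbol naming a transcendental real with δ(c)=1) and the claim fails. *)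

theory Defs
  imports
    "HOL-Analysis.Product_Topology"
    "HOL-Analysis.Function_Topology"
    "HOL-Analysis.T1_Spaces"
    "HOL-Library.Equipollence"
    "HOL-Algebra.Generated_Fields"
    "HOL-Algebra.Finite_Extensions"
    "HOL-Algebra.Indexed_Polynomials"
begin

section \<open>First-order logic\<close>

datatype 'f tm = Var nat | Fn 'f "'f tm list"

datatype ('f, 'r) fm =
    Eq "'f tm" "'f tm"
  | Rel 'r "'f tm list"
  | Neg "('f, 'r) fm"
  | And "('f, 'r) fm" "('f, 'r) fm"
  | Or "('f, 'r) fm" "('f, 'r) fm"
  | Ex nat "('f, 'r) fm"
  | All nat "('f, 'r) fm"

record ('f, 'r) lang =
  funs :: "'f set"
  fun_ar :: "'f \<Rightarrow> nat"
  rels :: "'r set"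
  rel_ar :: "'r \<Rightarrow> nat"

text \<open>A structure interprets every symbol of the types \<open>'f\<close> and \<open>'r\<close>; only the symbols of the
  language at hand, applied to argument lists of the right length, matter.  Hence a reduct is the
  same structure, considered in a smaller language.\<close>

record ('a, 'f, 'r) struct =
  univ :: "'a set"
  fn :: "'f \<Rightarrow> 'a list \<Rightarrow> 'a"
  rl :: "'r \<Rightarrow> 'a list \<Rightarrow> bool"

fun tm_in :: "('f, 'r) lang \<Rightarrow> 'f tm \<Rightarrow> bool" where
  "tm_in L (Var i) = True"
| "tm_in L (Fn f ts) = (f \<in> funs L \<and> length ts = fun_ar L f \<and> (\<forall>t \<in> set ts. tm_in L t))"

fun fm_in :: "('f, 'r) lang \<Rightarrow> ('f, 'r) fm \<Rightarrow> bool" where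
  "fm_in L (Eq t u) = (tm_in L t \<and> tm_in L u)"
| "fm_in L (Rel r ts) = (r \<in> rels L \<and> length ts = rel_ar L r \<and> (\<forall>t \<in> set ts. tm_in L t))"
| "fm_in L (Neg \<phi>) = fm_in L \<phi>"
| "fm_in L (And \<phi> \<psi>) = (fm_in L \<phi> \<and> fm_in L \<psi>)"
| "fm_in L (Or \<phi> \<psi>) = (fm_in L \<phi> \<and> fm_in L \<psi>)"
| "fm_in L (Ex n \<phi>) = fm_in L \<phi>"
| "fm_in L (All n \<phi>) = fm_in L \<phi>"

definition formulas :: "('f, 'r) lang \<Rightarrow> ('f, 'r) fm set" where
  "formulas L = {\<phi>. fm_in L \<phi>}"

fun tm_vars :: "'f tm \<Rightarrow> nat set" where
  "tm_vars (Var i) = {i}"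
| "tm_vars (Fn f ts) = (\<Union>t \<in> set ts. tm_vars t)"

fun fv :: "('f, 'r) fm \<Rightarrow> nat set" where
  "fv (Eq t u) = tm_vars t \<union> tm_vars u"
| "fv (Rel r ts) = (\<Union>t \<in> set ts. tm_vars t)"
| "fv (Neg \<phi>) = fv \<phi>"
| "fv (And \<phi> \<psi>) = fv \<phi> \<union> fv \<psi>"
| "fv (Or \<phi> \<psi>) = fv \<phi> \<union> fv \<psi>"
| "fv (Ex n \<phi>) = fv \<phi> - {n}"
| "fv (All n \<phi>) = fv \<phi> - {n}"

definition sentences :: "('f, 'r) lang \<Rightarrow> ('f, 'r) fm set" where
  "sentences L = {\<phi> \<in> formulas L. fv \<phi> = {}}"

fun tm_val :: "('a, 'f, 'r) struct \<Rightarrow> (nat \<Rightarrow> 'a) \<Rightarrow> 'f tm \<Rightarrow> 'a" where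
  "tm_val M s (Var i) = s i"
| "tm_val M s (Fn f ts) = fn M f (map (tm_val M s) ts)"

fun sat :: "('a, 'f, 'r) struct \<Rightarrow> (nat \<Rightarrow> 'a) \<Rightarrow> ('f, 'r) fm \<Rightarrow> bool" where
  "sat M s (Eq t u) = (tm_val M s t = tm_val M s u)"
| "sat M s (Rel r ts) = rl M r (map (tm_val M s) ts)"
| "sat M s (Neg \<phi>) = (\<not> sat M s \<phi>)"
| "sat M s (And \<phi> \<psi>) = (sat M s \<phi> \<and> sat M s \<psi>)"
| "sat M s (Or \<phi> \<psi>) = (sat M s \<phi> \<or> sat M s \<psi>)"
| "sat M s (Ex n \<phi>) = (\<exists>a \<in> univ M. sat M (s(n := a)) \<phi>)"
| "sat M s (All n \<phi>) = (\<forall>a \<in> univ M. sat M (s(n := a)) \<phi>)"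

text \<open>A tuple of elements is given as an assignment of all variables; a formula only depends on
  the values at its finitely many free variables.\<close>

definition assigns :: "'a set \<Rightarrow> (nat \<Rightarrow> 'a) set" where
  "assigns B = {s. \<forall>i. s i \<in> B}"

definition is_struct :: "('f, 'r) lang \<Rightarrow> ('a, 'f, 'r) struct \<Rightarrow> bool" where
  "is_struct L M \<longleftrightarrow> univ M \<noteq> {} \<and>
     (\<forall>f \<in> funs L. \<forall>as. length as = fun_ar L f \<and> set as \<subseteq> univ M \<longrightarrow> fn M f as \<in> univ M)"

definition models :: "('f, 'r) lang \<Rightarrow> ('f, 'r) fm set \<Rightarrow> ('a, 'f, 'r) struct \<Rightarrow> bool" where
  "models L T M \<longleftrightarrow> is_struct L M \<and> (\<forall>\<phi> \<in> T. \<forall>s \<in> assigns (univ M). sat M s \<phi>)"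

definition substructure ::
  "('f, 'r) lang \<Rightarrow> ('a, 'f, 'r) struct \<Rightarrow> ('a, 'f, 'r) struct \<Rightarrow> bool" where
  "substructure L M N \<longleftrightarrow> is_struct L M \<and> is_struct L N \<and> univ M \<subseteq> univ N \<and>
     (\<forall>f \<in> funs L. \<forall>as. length as = fun_ar L f \<and> set as \<subseteq> univ M \<longrightarrow> fn M f as = fn N f as) \<and>
     (\<forall>r \<in> rels L. \<forall>as. length as = rel_ar L r \<and> set as \<subseteq> univ M \<longrightarrow> rl M r as = rl N r as)"

definition elementary_substructure ::
  "('f, 'r) lang \<Rightarrow> ('a, 'f, 'r) struct \<Rightarrow> ('a, 'f, 'r) struct \<Rightarrow> bool" where
  "elementary_substructure L M N \<longleftrightarrow> substructure L M N \<and>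
     (\<forall>\<phi> \<in> formulas L. \<forall>s \<in> assigns (univ M). sat M s \<phi> \<longleftrightarrow> sat N s \<phi>)"

definition elementary_embedding ::
  "('f, 'r) lang \<Rightarrow> ('a, 'f, 'r) struct \<Rightarrow> ('a, 'f, 'r) struct \<Rightarrow> ('a \<Rightarrow> 'a) \<Rightarrow> bool" where
  "elementary_embedding L M N e \<longleftrightarrow> e ` univ M \<subseteq> univ N \<and>
     (\<forall>\<phi> \<in> formulas L. \<forall>s \<in> assigns (univ M). sat M s \<phi> \<longleftrightarrow> sat N (e \<circ> s) \<phi>)"

fun quantifier_free :: "('f, 'r) fm \<Rightarrow> bool" where
  "quantifier_free (Eq t u) = True"
| "quantifier_free (Rel r ts) = True"
| "quantifier_free (Neg \<phi>) = quantifier_free \<phi>"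
| "quantifier_free (And \<phi> \<psi>) = (quantifier_free \<phi> \<and> quantifier_free \<psi>)"
| "quantifier_free (Or \<phi> \<psi>) = (quantifier_free \<phi> \<and> quantifier_free \<psi>)"
| "quantifier_free (Ex n \<phi>) = False"
| "quantifier_free (All n \<phi>) = False"

fun positive_existential :: "('f, 'r) fm \<Rightarrow> bool" where
  "positive_existential (Eq t u) = True"
| "positive_existential (Rel r ts) = True"
| "positive_existential (And \<phi> \<psi>) = (positive_existential \<phi> \<and> positive_existential \<psi>)"
| "positive_existential (Or \<phi> \<psi>) = (positive_existential \<phi> \<and> positive_existential \<psi>)"
| "positive_existential (Ex n \<phi>) = positive_existential \<phi>"
| "positive_existential (Neg \<phi>) = False"
| "positive_existential (All n \<phi>) = False"

fun conj_of_atomic :: "('f, 'r) fm \<Rightarrow> bool" where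
  "conj_of_atomic (Eq t u) = True"
| "conj_of_atomic (Rel r ts) = True"
| "conj_of_atomic (And \<phi> \<psi>) = (conj_of_atomic \<phi> \<and> conj_of_atomic \<psi>)"
| "conj_of_atomic _ = False"

fun positive_primitive :: "('f, 'r) fm \<Rightarrow> bool" where
  "positive_primitive (Ex n \<phi>) = positive_primitive \<phi>"
| "positive_primitive \<phi> = conj_of_atomic \<phi>"

text \<open>HOL does not quantify over types inside a proposition, so ``all models of \<open>T\<close>'' means all
  models whose universe is a subset of a type \<open>'a\<close>, which is passed as an argument of type
  \<open>'a itself\<close>.  If \<open>'a\<close> is infinite and at least as large as the language, then by compactness and
  the Loewenheim-Skolem theorem the properties of \<open>T\<close> defined with such quantifiers do not depend
  on \<open>'a\<close>.\<close>

definition complete_theory :: "'a itself \<Rightarrow> ('f, 'r) lang \<Rightarrow> ('f, 'r) fm set \<Rightarrow> bool" where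
  "complete_theory (_ :: 'a itself) L T \<longleftrightarrow> T \<subseteq> sentences L \<and>
     (\<exists>M :: ('a, 'f, 'r) struct. models L T M) \<and>
     (\<forall>\<sigma> \<in> sentences L.
        (\<forall>M :: ('a, 'f, 'r) struct. models L T M \<longrightarrow> (\<forall>s \<in> assigns (univ M). sat M s \<sigma>)) \<or>
        (\<forall>M :: ('a, 'f, 'r) struct. models L T M \<longrightarrow> (\<forall>s \<in> assigns (univ M). \<not> sat M s \<sigma>)))"

definition quantifier_elimination :: "'a itself \<Rightarrow> ('f, 'r) lang \<Rightarrow> ('f, 'r) fm set \<Rightarrow> bool" where
  "quantifier_elimination (_ :: 'a itself) L T \<longleftrightarrow>
     (\<forall>\<phi> \<in> formulas L. \<exists>\<psi> \<in> formulas L. quantifier_free \<psi> \<and> fv \<psi> \<subseteq> fv \<phi> \<and>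
        (\<forall>M :: ('a, 'f, 'r) struct. models L T M \<longrightarrow>
           (\<forall>s \<in> assigns (univ M). sat M s \<phi> \<longleftrightarrow> sat M s \<psi>)))"

definition dagger :: "'a itself \<Rightarrow> ('f, 'r) lang \<Rightarrow> ('f, 'r) fm set \<Rightarrow> bool" where
  "dagger (_ :: 'a itself) L T \<longleftrightarrow>
     (\<forall>r \<in> rels L. \<exists>\<psi> \<in> formulas L. positive_existential \<psi> \<and> fv \<psi> \<subseteq> {..<rel_ar L r} \<and>
        (\<forall>M :: ('a, 'f, 'r) struct. models L T M \<longrightarrow>
           (\<forall>s \<in> assigns (univ M).
              sat M s (Neg (Rel r (map Var [0..<rel_ar L r]))) \<longleftrightarrow> sat M s \<psi>)))"

text \<open>Definable means definable with parameters; elements of the \<open>n\<close>-th power are extensional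
  functions on \<open>{..<n}\<close>.\<close>

definition definable_sets ::
  "('f, 'r) lang \<Rightarrow> ('a, 'f, 'r) struct \<Rightarrow> nat \<Rightarrow> (nat \<Rightarrow> 'a) set set" where
  "definable_sets L M n =
     {{x \<in> {..<n} \<rightarrow>\<^sub>E univ M. sat M (\<lambda>i. if i < n then x i else s i) \<phi>} | \<phi> s.
        \<phi> \<in> formulas L \<and> s \<in> assigns (univ M)}"

definition acl :: "('f, 'r) lang \<Rightarrow> ('a, 'f, 'r) struct \<Rightarrow> 'a set \<Rightarrow> 'a set" where
  "acl L M B = {a \<in> univ M. \<exists>\<phi> \<in> formulas L. \<exists>s \<in> assigns (univ M).
      (\<forall>i \<in> fv \<phi> - {0}. s i \<in> B) \<and> sat M (s(0 := a)) \<phi> \<and>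
      finite {c \<in> univ M. sat M (s(0 := c)) \<phi>}}"

definition acl_closed :: "('f, 'r) lang \<Rightarrow> ('a, 'f, 'r) struct \<Rightarrow> 'a set \<Rightarrow> bool" where
  "acl_closed L M B \<longleftrightarrow> acl L M B = B"


section \<open>Fields as first-order structures\<close>

text \<open>\<open>FDelta\<close> and \<open>FP\<close> are the additional symbols of the languages \<open>\<L>\<^sub>\<delta>\<close> and \<open>\<L>\<^sub>p\<close>.\<close>

datatype 'c fsym = FAdd | FSub | FMul | FInv | FZero | FOne | FCst 'c | FDelta | FP

fun fsym_ar :: "'c fsym \<Rightarrow> nat" where
  "fsym_ar FAdd = 2"
| "fsym_ar FSub = 2"
| "fsym_ar FMul = 2"
| "fsym_ar FInv = 1"
| "fsym_ar FZero = 0"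
| "fsym_ar FOne = 0"
| "fsym_ar (FCst c) = 0"
| "fsym_ar FDelta = 1"
| "fsym_ar FP = 2"

definition field_language :: "('c fsym, 'r) lang \<Rightarrow> bool" where
  "field_language L \<longleftrightarrow> fun_ar L = fsym_ar \<and>
     {FAdd, FSub, FMul, FInv, FZero, FOne} \<subseteq> funs L \<and>
     funs L \<subseteq> {FAdd, FSub, FMul, FInv, FZero, FOne} \<union> range FCst"

definition lang_delta :: "('c fsym, 'r) lang \<Rightarrow> ('c fsym, 'r) lang" where
  "lang_delta L = L\<lparr>funs := insert FDelta (funs L)\<rparr>"

definition lang_p :: "('c fsym, 'r) lang \<Rightarrow> ('c fsym, 'r) lang" where
  "lang_p L = L\<lparr>funs := insert FP (funs L)\<rparr>"

definition const_values :: "('c fsym, 'r) lang \<Rightarrow> ('a, 'c fsym, 'r) struct \<Rightarrow> 'a set" where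
  "const_values L K = {fn K (FCst c) [] | c. FCst c \<in> funs L}"

definition ring_of :: "('a, 'c fsym, 'r) struct \<Rightarrow> 'a ring" where
  "ring_of K = \<lparr>carrier = univ K, monoid.mult = (\<lambda>x y. fn K FMul [x, y]), one = fn K FOne [],
                zero = fn K FZero [], add = (\<lambda>x y. fn K FAdd [x, y])\<rparr>"

definition field_struct :: "('a, 'c fsym, 'r) struct \<Rightarrow> bool" where
  "field_struct K \<longleftrightarrow> field (ring_of K) \<and>
     (\<forall>x \<in> univ K. \<forall>y \<in> univ K. fn K FSub [x, y] = x \<ominus>\<^bsub>ring_of K\<^esub> y) \<and>
     (\<forall>x \<in> univ K. fn K FInv [x] =
        (if x = \<zero>\<^bsub>ring_of K\<^esub> then \<zero>\<^bsub>ring_of K\<^esub> else inv\<^bsub>ring_of K\<^esub> x))"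

definition char_zero :: "('a, 'c fsym, 'r) struct \<Rightarrow> bool" where
  "char_zero K \<longleftrightarrow> (\<forall>n :: nat. 0 < n \<longrightarrow> [n] \<cdot>\<^bsub>ring_of K\<^esub> \<one>\<^bsub>ring_of K\<^esub> \<noteq> \<zero>\<^bsub>ring_of K\<^esub>)"


section \<open>Polynomials\<close>

text \<open>A polynomial over \<open>B\<close> in variables indexed by \<open>I\<close> is an element of the library's
  \<open>ring.indexed_pset R I B\<close>, i.e. a coefficient function on monomials, which are multisets of
  indices.\<close>

definition mpeval :: "'a ring \<Rightarrow> (nat multiset \<Rightarrow> 'a) \<Rightarrow> (nat \<Rightarrow> 'a) \<Rightarrow> 'a" where
  "mpeval R P x = (\<Oplus>\<^bsub>R\<^esub> M \<in> {M. P M \<noteq> \<zero>\<^bsub>R\<^esub>}.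
     P M \<otimes>\<^bsub>R\<^esub> (\<Otimes>\<^bsub>R\<^esub> i \<in> set_mset M. x i [^]\<^bsub>R\<^esub> count M i))"

definition mpderiv :: "'a ring \<Rightarrow> nat \<Rightarrow> (nat multiset \<Rightarrow> 'a) \<Rightarrow> (nat multiset \<Rightarrow> 'a)" where
  "mpderiv R i P = (\<lambda>M. [Suc (count M i)] \<cdot>\<^bsub>R\<^esub> P (add_mset i M))"

definition zariski_closed :: "('a, 'c fsym, 'r) struct \<Rightarrow> nat \<Rightarrow> (nat \<Rightarrow> 'a) set \<Rightarrow> bool" where
  "zariski_closed K n Z \<longleftrightarrow> (\<exists>F \<subseteq> ring.indexed_pset (ring_of K) {..<n} (univ K).
      Z = {x \<in> {..<n} \<rightarrow>\<^sub>E univ K. \<forall>P \<in> F. mpeval (ring_of K) P x = \<zero>\<^bsub>ring_of K\<^esub>})"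


section \<open>Open theories of topological fields\<close>

text \<open>The translation invariant topology in which the members of \<open>\<B>\<close> are to be a basis of
  neighbourhoods of 0.  That they are one is a separate property, \<open>zero_basis\<close>.\<close>

definition translation_topology :: "('a, 'c fsym, 'r) struct \<Rightarrow> 'a set set \<Rightarrow> 'a topology" where
  "translation_topology K \<B> = topology (\<lambda>U. U \<subseteq> univ K \<and>
     (\<forall>a \<in> U. \<exists>V \<in> \<B>. (\<lambda>y. fn K FAdd [a, y]) ` V \<subseteq> U))"

definition zero_basis :: "('a, 'c fsym, 'r) struct \<Rightarrow> 'a topology \<Rightarrow> 'a set set \<Rightarrow> bool" where
  "zero_basis K \<tau> \<B> \<longleftrightarrow>
     (\<forall>V \<in> \<B>. V \<subseteq> topspace \<tau> \<and> (\<exists>U. openin \<tau> U \<and> fn K FZero [] \<in> U \<and> U \<subseteq> V)) \<and>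
     (\<forall>U. openin \<tau> U \<and> fn K FZero [] \<in> U \<longrightarrow> (\<exists>V \<in> \<B>. V \<subseteq> U))"

definition field_topology :: "('a, 'c fsym, 'r) struct \<Rightarrow> 'a topology \<Rightarrow> bool" where
  "field_topology K \<tau> \<longleftrightarrow> topspace \<tau> = univ K \<and>
     continuous_map (prod_topology \<tau> \<tau>) \<tau> (\<lambda>(x, y). fn K FAdd [x, y]) \<and>
     continuous_map (prod_topology \<tau> \<tau>) \<tau> (\<lambda>(x, y). fn K FSub [x, y]) \<and>
     continuous_map (prod_topology \<tau> \<tau>) \<tau> (\<lambda>(x, y). fn K FMul [x, y]) \<and>
     continuous_map (subtopology \<tau> (univ K - {fn K FZero []})) \<tau> (\<lambda>x. fn K FInv [x])"

text \<open>In \<open>\<chi>(x, z)\<close> the variable \<open>x\<close> is \<open>Var 0\<close>; all other variables belong to the parameter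
  tuple.\<close>

definition chi_set ::
  "('c fsym, 'r) fm \<Rightarrow> ('a, 'c fsym, 'r) struct \<Rightarrow> (nat \<Rightarrow> 'a) \<Rightarrow> 'a set" where
  "chi_set \<chi> K s = {a \<in> univ K. sat K (s(0 := a)) \<chi>}"

definition chi_basis :: "('c fsym, 'r) fm \<Rightarrow> ('a, 'c fsym, 'r) struct \<Rightarrow> 'a set set" where
  "chi_basis \<chi> K = {chi_set \<chi> K s | s. s \<in> assigns (univ K) \<and> fn K FZero [] \<in> chi_set \<chi> K s}"

definition def_top :: "('c fsym, 'r) fm \<Rightarrow> ('a, 'c fsym, 'r) struct \<Rightarrow> 'a topology" where
  "def_top \<chi> K = translation_topology K (chi_basis \<chi> K)"

abbreviation def_top_power ::
  "('c fsym, 'r) fm \<Rightarrow> ('a, 'c fsym, 'r) struct \<Rightarrow> nat \<Rightarrow> (nat \<Rightarrow> 'a) topology" where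
  "def_top_power \<chi> K n \<equiv> product_topology (\<lambda>_. def_top \<chi> K) {..<n}"

definition open_theory ::
  "'a itself \<Rightarrow> ('c fsym, 'r) lang \<Rightarrow> ('c fsym, 'r) fm \<Rightarrow> ('c fsym, 'r) fm set \<Rightarrow> bool" where
  "open_theory (A :: 'a itself) L \<chi> T \<longleftrightarrow> complete_theory A L T \<and> \<chi> \<in> formulas L \<and>
     (\<forall>K :: ('a, 'c fsym, 'r) struct. models L T K \<longrightarrow>
        field_struct K \<and> char_zero K \<and>
        zero_basis K (def_top \<chi> K) (chi_basis \<chi> K) \<and>
        field_topology K (def_top \<chi> K) \<and>
        Hausdorff_space (def_top \<chi> K) \<and>
        def_top \<chi> K \<noteq> discrete_topology (univ K) \<and>
        (\<forall>n. \<forall>S \<in> definable_sets L K n. \<exists>m :: nat. \<exists>Z U.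
           (\<forall>i < m. zariski_closed K n (Z i) \<and>
                    U i \<in> definable_sets L K n \<and> openin (def_top_power \<chi> K n) (U i)) \<and>
           S = (\<Union>i < m. Z i \<inter> U i)))"

text \<open>The algebraic closure is taken over the constant symbols of \<open>L\<close>.  For a language with
  relation symbols this does not follow from \<open>open_theory\<close>: naming the element \<open>\<pi>\<close> of the real
  field by a unary predicate (and then every formula by a relation symbol) gives an open theory
  with \<open>\<pi>\<close> in \<open>acl {}\<close>.\<close>

definition acl_is_algebraic_closure ::
  "'a itself \<Rightarrow> ('c fsym, 'r) lang \<Rightarrow> ('c fsym, 'r) fm set \<Rightarrow> bool" where
  "acl_is_algebraic_closure (_ :: 'a itself) L T \<longleftrightarrow>
     (\<forall>K :: ('a, 'c fsym, 'r) struct. models L T K \<longrightarrow>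
        (\<forall>B \<subseteq> univ K. acl L K B = {a \<in> univ K.
           ((ring.algebraic (ring_of K)) over
              (generate_field (ring_of K) (B \<union> const_values L K))) a}))"


section \<open>Henselian valuations\<close>

text \<open>A valuation is a map onto an ordered abelian group \<open>\<Gamma>\<close> (written multiplicatively, with
  order \<open>leq\<close>); its value at 0, which is \<open>\<infinity>\<close>, is not represented.  Since \<open>\<Gamma>\<close> is a quotient of the
  multiplicative group, it can be assumed to live on the same type as the field.\<close>

definition valuation ::
  "('a, 'c fsym, 'r) struct \<Rightarrow> 'a monoid \<Rightarrow> ('a \<Rightarrow> 'a \<Rightarrow> bool) \<Rightarrow> ('a \<Rightarrow> 'a) \<Rightarrow> bool" where
  "valuation K \<Gamma> leq v \<longleftrightarrow>
     comm_group \<Gamma> \<and>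
     (\<forall>a \<in> carrier \<Gamma>. leq a a) \<and>
     (\<forall>a \<in> carrier \<Gamma>. \<forall>b \<in> carrier \<Gamma>. leq a b \<and> leq b a \<longrightarrow> a = b) \<and>
     (\<forall>a \<in> carrier \<Gamma>. \<forall>b \<in> carrier \<Gamma>. \<forall>c \<in> carrier \<Gamma>. leq a b \<and> leq b c \<longrightarrow> leq a c) \<and>
     (\<forall>a \<in> carrier \<Gamma>. \<forall>b \<in> carrier \<Gamma>. leq a b \<or> leq b a) \<and>
     (\<forall>a \<in> carrier \<Gamma>. \<forall>b \<in> carrier \<Gamma>. \<forall>c \<in> carrier \<Gamma>. leq a b \<longrightarrow> leq (a \<otimes>\<^bsub>\<Gamma>\<^esub> c) (b \<otimes>\<^bsub>\<Gamma>\<^esub> c)) \<and>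
     v ` (univ K - {fn K FZero []}) = carrier \<Gamma> \<and>
     (\<forall>x \<in> univ K - {fn K FZero []}. \<forall>y \<in> univ K - {fn K FZero []}.
        v (fn K FMul [x, y]) = v x \<otimes>\<^bsub>\<Gamma>\<^esub> v y \<and>
        (fn K FAdd [x, y] \<noteq> fn K FZero [] \<longrightarrow>
           leq (v x) (v (fn K FAdd [x, y])) \<or> leq (v y) (v (fn K FAdd [x, y]))))"

definition open_val_ball ::
  "('a, 'c fsym, 'r) struct \<Rightarrow> ('a \<Rightarrow> 'a \<Rightarrow> bool) \<Rightarrow> ('a \<Rightarrow> 'a) \<Rightarrow> 'a \<Rightarrow> 'a set" where
  "open_val_ball K leq v \<gamma> =
     {x \<in> univ K. x = fn K FZero [] \<or> (leq \<gamma> (v x) \<and> v x \<noteq> \<gamma>)}"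

definition val_ring ::
  "('a, 'c fsym, 'r) struct \<Rightarrow> 'a monoid \<Rightarrow> ('a \<Rightarrow> 'a \<Rightarrow> bool) \<Rightarrow> ('a \<Rightarrow> 'a) \<Rightarrow> 'a set" where
  "val_ring K \<Gamma> leq v = {x \<in> univ K. x = fn K FZero [] \<or> leq \<one>\<^bsub>\<Gamma>\<^esub> (v x)}"

definition max_ideal ::
  "('a, 'c fsym, 'r) struct \<Rightarrow> 'a monoid \<Rightarrow> ('a \<Rightarrow> 'a \<Rightarrow> bool) \<Rightarrow> ('a \<Rightarrow> 'a) \<Rightarrow> 'a set" where
  "max_ideal K \<Gamma> leq v = open_val_ball K leq v \<one>\<^bsub>\<Gamma>\<^esub>"

definition henselian_valuation ::
  "('a, 'c fsym, 'r) struct \<Rightarrow> 'a monoid \<Rightarrow> ('a \<Rightarrow> 'a \<Rightarrow> bool) \<Rightarrow> ('a \<Rightarrow> 'a) \<Rightarrow> bool" where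
  "henselian_valuation K \<Gamma> leq v \<longleftrightarrow> valuation K \<Gamma> leq v \<and>
     (\<forall>P \<in> ring.indexed_pset (ring_of K) {0} (val_ring K \<Gamma> leq v). \<forall>a \<in> val_ring K \<Gamma> leq v.
        mpeval (ring_of K) P (\<lambda>_. a) \<in> max_ideal K \<Gamma> leq v \<and>
        mpeval (ring_of K) (mpderiv (ring_of K) 0 P) (\<lambda>_. a) \<notin> max_ideal K \<Gamma> leq v \<longrightarrow>
        (\<exists>b \<in> val_ring K \<Gamma> leq v.
           mpeval (ring_of K) P (\<lambda>_. b) = fn K FZero [] \<and> fn K FSub [b, a] \<in> max_ideal K \<Gamma> leq v))"

definition val_top ::
  "('a, 'c fsym, 'r) struct \<Rightarrow> 'a monoid \<Rightarrow> ('a \<Rightarrow> 'a \<Rightarrow> bool) \<Rightarrow> ('a \<Rightarrow> 'a) \<Rightarrow> 'a topology" where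
  "val_top K \<Gamma> leq v = translation_topology K (open_val_ball K leq v ` carrier \<Gamma>)"

text \<open>Elementary extensions are elementary embeddings, because the universe
  of \<open>K\<close> may already exhaust the type \<open>'a\<close>.\<close>

definition dagger_large ::
  "'a itself \<Rightarrow> ('c fsym, 'r) lang \<Rightarrow> ('c fsym, 'r) fm \<Rightarrow> ('c fsym, 'r) fm set \<Rightarrow> bool" where
  "dagger_large (_ :: 'a itself) L \<chi> T \<longleftrightarrow>
     (\<forall>K :: ('a, 'c fsym, 'r) struct. models L T K \<longrightarrow>
        (\<exists>(K' :: ('a, 'c fsym, 'r) struct) e \<Gamma> leq v.
           is_struct L K' \<and> elementary_embedding L K K' e \<and>
           henselian_valuation K' \<Gamma> leq v \<and> val_top K' \<Gamma> leq v = def_top \<chi> K'))"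


section \<open>Generic derivations\<close>

definition derivation :: "('a, 'c fsym, 'r) struct \<Rightarrow> bool" where
  "derivation K \<longleftrightarrow> (\<forall>x \<in> univ K. \<forall>y \<in> univ K.
     fn K FDelta [fn K FAdd [x, y]] = fn K FAdd [fn K FDelta [x], fn K FDelta [y]] \<and>
     fn K FDelta [fn K FMul [x, y]] =
       fn K FAdd [fn K FMul [fn K FDelta [x], y], fn K FMul [x, fn K FDelta [y]]])"

definition models_T_delta ::
  "('c fsym, 'r) lang \<Rightarrow> ('c fsym, 'r) fm set \<Rightarrow> ('a, 'c fsym, 'r) struct \<Rightarrow> bool" where
  "models_T_delta L T K \<longleftrightarrow> is_struct (lang_delta L) K \<and> models L T K \<and> derivation K"

definition jet :: "('a, 'c fsym, 'r) struct \<Rightarrow> nat \<Rightarrow> 'a \<Rightarrow> nat \<Rightarrow> 'a" where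
  "jet K n b = (\<lambda>i \<in> {..<n}. ((\<lambda>x. fn K FDelta [x]) ^^ i) b)"

text \<open>A differential polynomial \<open>q\<close> of order \<open>m\<close> is given by \<open>q\<^sup>*\<close>, a polynomial in
  \<open>y\<^sub>0, \<dots>, y\<^sub>m\<close> in which \<open>y\<^sub>m\<close> occurs; its values are those of \<open>q\<^sup>*\<close> at jets.\<close>

definition scheme_DL ::
  "('c fsym, 'r) fm \<Rightarrow> ('a, 'c fsym, 'r) struct \<Rightarrow> bool" where
  "scheme_DL \<chi> K \<longleftrightarrow>
     (\<forall>m \<ge> 1. \<forall>q \<in> ring.indexed_pset (ring_of K) {..<Suc m} (univ K).
        \<not> ring.index_free (ring_of K) q m \<longrightarrow>
        (\<forall>a \<in> {..<Suc m} \<rightarrow>\<^sub>E univ K. \<forall>W U.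
           mpeval (ring_of K) q a = fn K FZero [] \<and>
           mpeval (ring_of K) (mpderiv (ring_of K) m q) a \<noteq> fn K FZero [] \<and>
           openin (def_top_power \<chi> K (Suc m)) U \<and> a \<in> U \<and> U \<subseteq> W \<longrightarrow>
           (\<exists>b \<in> univ K.
              mpeval (ring_of K) q (jet K (Suc m) b) = fn K FZero [] \<and>
              mpeval (ring_of K) (mpderiv (ring_of K) m q) (jet K (Suc m) b) \<noteq> fn K FZero [] \<and>
              jet K (Suc m) b \<in> W)))"

definition models_T_delta_star ::
  "('c fsym, 'r) lang \<Rightarrow> ('c fsym, 'r) fm \<Rightarrow> ('c fsym, 'r) fm set \<Rightarrow>
   ('a, 'c fsym, 'r) struct \<Rightarrow> bool" where
  "models_T_delta_star L \<chi> T K \<longleftrightarrow> models_T_delta L T K \<and> scheme_DL \<chi> K"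


section \<open>Boolean algebras as first-order structures\<close>

datatype ba_sym = BJoin | BMeet | BCompl | BBot | BTop

fun ba_ar :: "ba_sym \<Rightarrow> nat" where
  "ba_ar BJoin = 2"
| "ba_ar BMeet = 2"
| "ba_ar BCompl = 1"
| "ba_ar BBot = 0"
| "ba_ar BTop = 0"

text \<open>There are no relation symbols; \<open>unit\<close> is a dummy.\<close>

definition ba_lang :: "(ba_sym, unit) lang" where
  "ba_lang = \<lparr>funs = UNIV, fun_ar = ba_ar, rels = {}, rel_ar = (\<lambda>_. 0)\<rparr>"

definition boolean_algebra_struct :: "('a, ba_sym, unit) struct \<Rightarrow> bool" where
  "boolean_algebra_struct B \<longleftrightarrow> is_struct ba_lang B \<and>
     (\<forall>x \<in> univ B. \<forall>y \<in> univ B. \<forall>z \<in> univ B.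
        fn B BJoin [x, y] = fn B BJoin [y, x] \<and>
        fn B BMeet [x, y] = fn B BMeet [y, x] \<and>
        fn B BJoin [x, fn B BMeet [y, z]] = fn B BMeet [fn B BJoin [x, y], fn B BJoin [x, z]] \<and>
        fn B BMeet [x, fn B BJoin [y, z]] = fn B BJoin [fn B BMeet [x, y], fn B BMeet [x, z]] \<and>
        fn B BJoin [x, fn B BBot []] = x \<and>
        fn B BMeet [x, fn B BTop []] = x \<and>
        fn B BJoin [x, fn B BCompl [x]] = fn B BTop [] \<and>
        fn B BMeet [x, fn B BCompl [x]] = fn B BBot [])"

text \<open>Countable models suffice here, as \<open>ba_lang\<close> is finite.\<close>

definition complete_ba_theory :: "(ba_sym, unit) fm set \<Rightarrow> bool" where
  "complete_ba_theory \<T> \<longleftrightarrow> complete_theory TYPE(nat) ba_lang \<T> \<and>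
     (\<forall>B :: (nat, ba_sym, unit) struct. models ba_lang \<T> B \<longrightarrow> boolean_algebra_struct B)"

definition set_algebra :: "'x set \<Rightarrow> 'x set set \<Rightarrow> ('x set, ba_sym, unit) struct" where
  "set_algebra S \<B> = \<lparr>univ = \<B>,
     fn = (\<lambda>f as. case f of
         BJoin \<Rightarrow> as ! 0 \<union> as ! 1
       | BMeet \<Rightarrow> as ! 0 \<inter> as ! 1
       | BCompl \<Rightarrow> S - as ! 0
       | BBot \<Rightarrow> {}
       | BTop \<Rightarrow> S),
     rl = (\<lambda>_ _. False)\<rparr>"


section \<open>Boolean products\<close>

definition boolean_space :: "'x topology \<Rightarrow> bool" where
  "boolean_space \<tau> \<longleftrightarrow> compact_space \<tau> \<and> Hausdorff_space \<tau> \<and>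
     (\<forall>S. connectedin \<tau> S \<longrightarrow> (\<exists>x. S \<subseteq> {x}))"

definition clopens :: "'x topology \<Rightarrow> 'x set set" where
  "clopens \<tau> = {U. openin \<tau> U \<and> closedin \<tau> U}"

record ('x, 'a, 'f, 'r) bprod =
  base :: "'x topology"
  fiber :: "'x \<Rightarrow> ('a, 'f, 'r) struct"
  elems :: "('x \<Rightarrow> 'a) set"

abbreviation points :: "('x, 'a, 'f, 'r) bprod \<Rightarrow> 'x set" where
  "points P \<equiv> topspace (base P)"

definition prod_of :: "('x, 'a, 'f, 'r) bprod \<Rightarrow> ('x \<Rightarrow> 'a, 'f, 'r) struct" where
  "prod_of P = \<lparr>univ = elems P,
     fn = (\<lambda>f as. \<lambda>x \<in> points P. fn (fiber P x) f (map (\<lambda>a. a x) as)),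
     rl = (\<lambda>r as. \<forall>x \<in> points P. rl (fiber P x) r (map (\<lambda>a. a x) as))\<rparr>"

definition subdirect_product :: "('f, 'r) lang \<Rightarrow> ('x, 'a, 'f, 'r) bprod \<Rightarrow> bool" where
  "subdirect_product L P \<longleftrightarrow>
     elems P \<subseteq> (\<Pi>\<^sub>E x \<in> points P. univ (fiber P x)) \<and> is_struct L (prod_of P) \<and>
     (\<forall>x \<in> points P. (\<lambda>f. f x) ` elems P = univ (fiber P x))"

definition truth_set :: "('x, 'a, 'f, 'r) bprod \<Rightarrow> ('f, 'r) fm \<Rightarrow> (nat \<Rightarrow> 'x \<Rightarrow> 'a) \<Rightarrow> 'x set" where
  "truth_set P \<phi> s = {x \<in> points P. sat (fiber P x) (\<lambda>i. s i x) \<phi>}"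

definition truth_sets :: "('f, 'r) lang \<Rightarrow> ('x, 'a, 'f, 'r) bprod \<Rightarrow> 'x set set" where
  "truth_sets L P = {truth_set P \<phi> s | \<phi> s. \<phi> \<in> formulas L \<and> s \<in> assigns (elems P)}"

definition patchwork :: "('x, 'a, 'f, 'r) bprod \<Rightarrow> 'x set set \<Rightarrow> bool" where
  "patchwork P \<U> \<longleftrightarrow> (\<forall>f \<in> elems P. \<forall>g \<in> elems P. \<forall>U \<in> \<U>. \<exists>h \<in> elems P.
     U \<subseteq> {x \<in> points P. f x = h x} \<and> points P - U \<subseteq> {x \<in> points P. g x = h x})"

text \<open>\<open>\<Gamma>\<^sup>e(T\<^sub>0)\<close> and \<open>\<Gamma>\<^sup>e\<close> relative to a theory of Boolean algebras; \<open>\<K>\<close> is the class of models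
  of \<open>T\<^sub>0\<close>.\<close>

definition Gamma_e ::
  "('f, 'r) lang \<Rightarrow> (('a, 'f, 'r) struct \<Rightarrow> bool) \<Rightarrow> ('x, 'a, 'f, 'r) bprod \<Rightarrow> bool" where
  "Gamma_e L \<K> P \<longleftrightarrow> boolean_space (base P) \<and> (\<forall>x \<in> points P. \<K> (fiber P x)) \<and>
     subdirect_product L P \<and> patchwork P (clopens (base P)) \<and>
     truth_sets L P \<subseteq> clopens (base P)"

definition Gamma_e_ba ::
  "('f, 'r) lang \<Rightarrow> (ba_sym, unit) fm set \<Rightarrow> (('a, 'f, 'r) struct \<Rightarrow> bool) \<Rightarrow>
   ('x, 'a, 'f, 'r) bprod \<Rightarrow> bool" where
  "Gamma_e_ba L \<T> \<K> P \<longleftrightarrow> Gamma_e L \<K> P \<and>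
     models ba_lang \<T> (set_algebra (points P) (clopens (base P)))"

definition struct_p :: "('a, 'c fsym, 'r) struct \<Rightarrow> ('a, 'c fsym, 'r) struct" where
  "struct_p K = K\<lparr>fn := (fn K)(FP :=
     (\<lambda>as. if as ! 1 = fn K FZero [] then as ! 0 else fn K FZero []))\<rparr>"

definition bprod_p :: "('x, 'a, 'c fsym, 'r) bprod \<Rightarrow> ('x, 'a, 'c fsym, 'r) bprod" where
  "bprod_p P = P\<lparr>fiber := (\<lambda>x. struct_p (fiber P x))\<rparr>"

definition chi_p_formula ::
  "'x itself \<Rightarrow> 'a itself \<Rightarrow> ('c fsym, 'r) lang \<Rightarrow> ('c fsym, 'r) fm set \<Rightarrow>
   ('c fsym, 'r) fm \<Rightarrow> ('c fsym, 'r) fm \<Rightarrow> bool" where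
  "chi_p_formula (_ :: 'x itself) (_ :: 'a itself) L T \<chi> \<chi>p \<longleftrightarrow>
     \<chi>p \<in> formulas (lang_p L) \<and> positive_primitive \<chi>p \<and>
     (\<forall>K :: ('a, 'c fsym, 'r) struct. models L T K \<longrightarrow>
        (\<forall>s \<in> assigns (univ K). sat K s \<chi> \<longleftrightarrow> sat (struct_p K) s \<chi>p)) \<and>
     (\<forall>P :: ('x, 'a, 'c fsym, 'r) bprod. Gamma_e L (models L T) P \<longrightarrow>
        (\<forall>s \<in> assigns (elems P).
           sat (prod_of (bprod_p P)) s \<chi>p \<longleftrightarrow> truth_set P \<chi> s = points P))"


section \<open>Dense pairs of Boolean products\<close>

definition sub_bprod :: "('x, 'a, 'f, 'r) bprod \<Rightarrow> ('x \<Rightarrow> 'a) set \<Rightarrow> ('x, 'a, 'f, 'r) bprod" where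
  "sub_bprod P D = P\<lparr>fiber := (\<lambda>x. (fiber P x)\<lparr>univ := (\<lambda>d. d x) ` D\<rparr>), elems := D\<rparr>"

text \<open>\<open>truth_sets L (sub_bprod P D)\<close> is the algebra with respect to which the substructure \<open>D\<close> is a
  model of \<open>\<Gamma>\<^sup>e(T)\<close> relative to \<open>\<T>\<close>: it consists of clopen sets, it need not contain all of them.\<close>

definition dense_pair ::
  "('c fsym, 'r) lang \<Rightarrow> ('c fsym, 'r) fm set \<Rightarrow> ('c fsym, 'r) fm \<Rightarrow> (ba_sym, unit) fm set \<Rightarrow>
   ('x, 'a, 'c fsym, 'r) bprod \<Rightarrow> ('x \<Rightarrow> 'a) set \<Rightarrow> bool" where
  "dense_pair L T \<chi>p \<T> P D \<longleftrightarrow>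
     Gamma_e_ba L \<T> (models L T) P \<and>
     substructure L ((prod_of P)\<lparr>univ := D\<rparr>) (prod_of P) \<and>
     (\<forall>x \<in> points P. models L T (fiber (sub_bprod P D) x)) \<and>
     truth_sets L (sub_bprod P D) \<subseteq> clopens (base P) \<and>
     patchwork (sub_bprod P D) (truth_sets L (sub_bprod P D)) \<and>
     models ba_lang \<T> (set_algebra (points P) (truth_sets L (sub_bprod P D))) \<and>
     elementary_substructure ba_lang
       (set_algebra (points P) (truth_sets L (sub_bprod P D)))
       (set_algebra (points P) (clopens (base P))) \<and>
     (\<forall>x \<in> points P. acl_closed L (fiber P x) (univ (fiber (sub_bprod P D) x))) \<and>
     (\<forall>r \<in> elems P. \<forall>s \<in> assigns (elems P).
        fn (prod_of P) FZero [] \<in> chi_set \<chi>p (prod_of (bprod_p P)) s \<longrightarrow>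
        (\<lambda>y. fn (prod_of P) FAdd [r, y]) ` chi_set \<chi>p (prod_of (bprod_p P)) s \<inter> D \<noteq> {}) \<and>
     (\<forall>x \<in> points P. \<forall>e \<in> clopens (base P). x \<in> e \<longrightarrow>
        (\<exists>e' \<in> truth_sets L (sub_bprod P D). x \<in> e' \<and> e' \<subseteq> e))"

definition constants :: "('x, 'a, 'c fsym, 'r) bprod \<Rightarrow> ('x \<Rightarrow> 'a) set" where
  "constants P = {a \<in> elems P. fn (prod_of P) FDelta [a] = fn (prod_of P) FZero []}"

end

theory Submission
  imports Defs
begin

text \<open>In a single model \<open>K\<close> of \<open>T\<^sup>*\<^sub>\<delta>\<close> the constants are dense (apply (DL) to \<open>q = \<delta>(y)\<close>) and relatively
  algebraically closed (differentiate a minimal polynomial).  A definable subset of \<open>K\<close> is finite,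
  hence contained in the algebraic closure of its parameters, or it has interior, hence contains a
  constant; by the Tarski-Vaught test the constants form an elementary substructure of \<open>K\<close>.

  For the Boolean product, pointwise solutions are glued by compactness and patchwork.  This gives
  density of the constants, and since the characteristic function of a clopen set is constant, their
  Boolean algebra consists of all clopen sets.  For elementarity, the truth of a formula at a
  tuple is determined by finitely many truth sets (Feferman-Vaught); gluing yields, for every element
  of the product, a constant with the same finitely many truth sets, and the Tarski-Vaught test
  applies again.\<close>

section \<open>Evaluation of indexed polynomials\<close>

text \<open>Truth in the product is not truth at every point: a negation can hold in the product
  although its truth set is not the whole base. Hence elementarity in the fibres cannot be glued
  formula by formula. What can be glued is a finite type: a condition given by finitely many truth
  sets cuts out a clopen set, so a solution at one point remains a solution on a clopen
  neighbourhood, and compactness applies.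

  Polynomials come in two encodings: coefficient functions on multisets, in Zariski closed sets and
  in (DL), and coefficient lists, for which roots are counted and algebraic elements are defined.
  Only the case of one variable has to be carried from the first to the second.\<close>

lemma (in ring) indexed_pset_finite_support:
  assumes "P \<in> indexed_pset I K"
  shows "finite {m. P m \<noteq> \<zero>}"
  using assms
proof induction
  case (indexed_const k)
  have "{m. indexed_const k m \<noteq> \<zero>} \<subseteq> {{#}}"
    by (auto simp: indexed_const_def)
  then show ?case
    using finite_subset by blast
next
  case (indexed_padd P Q)
  have "{m. indexed_padd P Q m \<noteq> \<zero>} \<subseteq> {m. P m \<noteq> \<zero>} \<union> {m. Q m \<noteq> \<zero>}"
    by (auto simp: indexed_padd_def)
  then show ?case
    using indexed_padd.IH finite_subset by blast
next
  case (indexed_pmult P i)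
  have "{m. indexed_pmult P i m \<noteq> \<zero>} \<subseteq> add_mset i ` {m. P m \<noteq> \<zero>}"
  proof
    fix m assume "m \<in> {m. indexed_pmult P i m \<noteq> \<zero>}"
    then have "i \<in># m" "P (m - {#i#}) \<noteq> \<zero>"
      by (auto simp: indexed_pmult_def split: if_splits)
    then show "m \<in> add_mset i ` {m. P m \<noteq> \<zero>}"
      by (intro image_eqI[of _ _ "m - {#i#}"]) auto
  qed
  then show ?case
    using indexed_pmult.IH finite_subset by blast
qed

text \<open>Points of a power of the field are extensional functions without a meaningful value off
  \<open>I\<close>; this bounds the variables that an evaluation reads.\<close>

lemma (in ring) indexed_pset_support:
  assumes "P \<in> indexed_pset I K" and "P m \<noteq> \<zero>"
  shows "set_mset m \<subseteq> I"
  using assms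
proof (induction arbitrary: m)
  case (indexed_const k)
  then show ?case
    by (auto simp: indexed_const_def split: if_splits)
next
  case (indexed_padd P Q)
  then have "P m \<noteq> \<zero> \<or> Q m \<noteq> \<zero>"
    by (auto simp: indexed_padd_def)
  then show ?case
    using indexed_padd.IH by blast
next
  case (indexed_pmult P i)
  then have "i \<in># m" "P (m - {#i#}) \<noteq> \<zero>"
    by (auto simp: indexed_pmult_def split: if_splits)
  moreover from this have "set_mset m = insert i (set_mset (m - {#i#}))"
    by (metis insert_DiffM set_mset_add_mset_insert)
  ultimately show ?case
    using indexed_pmult.IH indexed_pmult.hyps by auto
qed

section \<open>Monomials, and compatibility of evaluation with the generators of
  \<open>indexed_pset\<close>\<close>

definition monomial_value :: "('a, 'b) ring_scheme \<Rightarrow> (nat \<Rightarrow> 'a) \<Rightarrow> nat multiset \<Rightarrow> 'a" where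
  "monomial_value R x m = (\<Otimes>\<^bsub>R\<^esub> i \<in> set_mset m. x i [^]\<^bsub>R\<^esub> count m i)"

lemma (in cring) monomial_value_closed:
  assumes "x \<in> set_mset m \<rightarrow> carrier R"
  shows "monomial_value R x m \<in> carrier R"
  unfolding monomial_value_def using assms by (intro finprod_closed) auto

lemma (in cring) monomial_value_add_mset:
  assumes "x \<in> insert i (set_mset m) \<rightarrow> carrier R"
  shows "monomial_value R x (add_mset i m) = monomial_value R x m \<otimes> x i"
proof -
  define r where "r = (\<Otimes>j \<in> set_mset m - {i}. x j [^] count m j)"
  have xi: "x i \<in> carrier R" and r: "r \<in> carrier R"
    using assms unfolding r_def by (auto intro!: finprod_closed)
  \<comment> \<open>If \<open>i\<close> does not occur in \<open>m\<close>, its factor is the zeroth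
    power of \<open>x i\<close>, so the formula covers both cases.\<close>
  have m: "monomial_value R x m = x i [^] count m i \<otimes> r"
  proof (cases "i \<in># m")
    case True
    then have "set_mset m = insert i (set_mset m - {i})"
      by auto
    then have "monomial_value R x m = (\<Otimes>j \<in> insert i (set_mset m - {i}). x j [^] count m j)"
      unfolding monomial_value_def by simp
    also have "\<dots> = x i [^] count m i \<otimes> r"
      unfolding r_def using assms by (intro finprod_insert) auto
    finally show ?thesis .
  next
    case False
    then show ?thesis
      using r unfolding monomial_value_def r_def by (simp add: not_in_iff)
  qed
  have "monomial_value R x (add_mset i m) =
      (\<Otimes>j \<in> insert i (set_mset m - {i}). x j [^] count (add_mset i m) j)"
    unfolding monomial_value_def by (simp add: insert_Diff_if)
  also have "\<dots> = x i [^] Suc (count m i) \<otimes> (\<Otimes>j \<in> set_mset m - {i}. x j [^] count (add_mset i m) j)"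
    using assms by (subst finprod_insert) auto
  also have "(\<Otimes>j \<in> set_mset m - {i}. x j [^] count (add_mset i m) j) = r"
    unfolding r_def using assms by (intro finprod_cong) auto
  finally show ?thesis
    using m xi r by (simp add: m_ac)
qed

context
  fixes R :: "'a ring" (structure)
  assumes cring: "cring R"
begin

interpretation cring R
  by (rule cring)

text \<open>\<open>mpeval\<close> sums over the support of its own polynomial. Terms outside the
  support vanish, so the sums of several polynomials can be taken over one common range
  \<open>S\<close>.\<close>

lemma mpeval_eq_finsum:
  assumes "finite S" and "{m. P m \<noteq> \<zero>} \<subseteq> S" and "\<And>m. P m \<in> carrier R"
    and "\<And>m. m \<in> S \<Longrightarrow> monomial_value R x m \<in> carrier R"
  shows "mpeval R P x = (\<Oplus>m \<in> S. P m \<otimes> monomial_value R x m)"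
  unfolding mpeval_def monomial_value_def[symmetric]
  using assms by (intro add.finprod_mono_neutral_cong_left) auto

lemma mpeval_indexed_const:
  assumes "k \<in> carrier R"
  shows "mpeval R (indexed_const k) x = k"
proof -
  have "mpeval R (indexed_const k) x = (\<Oplus>m \<in> {{#}}. indexed_const k m \<otimes> monomial_value R x m)"
    by (rule mpeval_eq_finsum)
      (use assms in \<open>auto simp: indexed_const_def monomial_value_def split: if_splits\<close>)
  also have "\<dots> = k"
    using assms by (simp add: indexed_const_def monomial_value_def)
  finally show ?thesis .
qed

context
  fixes I :: "nat set" and x :: "nat \<Rightarrow> 'a"
  assumes x: "x \<in> I \<rightarrow> carrier R"
begin

lemma indexed_pset_monomial_value_closed:
  assumes "P \<in> indexed_pset I K" and "P m \<noteq> \<zero>"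
  shows "monomial_value R x m \<in> carrier R"
  using indexed_pset_support[OF assms] x by (intro monomial_value_closed) auto

lemma indexed_pset_coeff_closed:
  assumes "P \<in> indexed_pset I (carrier R)"
  shows "P m \<in> carrier R"
  using indexed_pset_in_carrier[OF subset_refl assms] by (rule carrier_coeffE)

lemma mpeval_indexed_padd:
  assumes "P \<in> indexed_pset I (carrier R)" and "Q \<in> indexed_pset I (carrier R)"
  shows "mpeval R (indexed_padd P Q) x = mpeval R P x \<oplus> mpeval R Q x"
proof -
  define S where "S = {m. P m \<noteq> \<zero>} \<union> {m. Q m \<noteq> \<zero>}"
  note supp = indexed_pset_finite_support[OF assms(1)] indexed_pset_finite_support[OF assms(2)]
  note coeff = indexed_pset_coeff_closed[OF assms(1)] indexed_pset_coeff_closed[OF assms(2)]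
  note val = indexed_pset_monomial_value_closed[OF assms(1)]
    indexed_pset_monomial_value_closed[OF assms(2)]
  have PQ: "indexed_padd P Q \<in> indexed_pset I (carrier R)"
    using assms by (rule indexed_pset.indexed_padd)
  have S: "finite S" "\<And>m. m \<in> S \<Longrightarrow> monomial_value R x m \<in> carrier R"
    using supp val unfolding S_def by auto
  have eval: "mpeval R F x = (\<Oplus>m \<in> S. F m \<otimes> monomial_value R x m)"
    if "F \<in> indexed_pset I (carrier R)" "{m. F m \<noteq> \<zero>} \<subseteq> S" for F
    using S that indexed_pset_coeff_closed indexed_pset_monomial_value_closed
    by (intro mpeval_eq_finsum) auto
  have "mpeval R (indexed_padd P Q) x = (\<Oplus>m \<in> S. indexed_padd P Q m \<otimes> monomial_value R x m)"
    using PQ by (rule eval) (auto simp: S_def indexed_padd_def)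
  also have "\<dots> = (\<Oplus>m \<in> S. P m \<otimes> monomial_value R x m \<oplus> Q m \<otimes> monomial_value R x m)"
    using S coeff by (intro finsum_cong) (auto simp: indexed_padd_def l_distr simp_implies_def)
  also have "\<dots> = (\<Oplus>m \<in> S. P m \<otimes> monomial_value R x m) \<oplus> (\<Oplus>m \<in> S. Q m \<otimes> monomial_value R x m)"
    using S coeff by (intro finsum_addf) auto
  also have "\<dots> = mpeval R P x \<oplus> mpeval R Q x"
    using eval[OF assms(1)] eval[OF assms(2)] by (simp add: S_def)
  finally show ?thesis .
qed

text \<open>Multiplying by a variable moves the support along the injective map
  \<open>add_mset i\<close>, along which the sum is reindexed.\<close>

lemma mpeval_indexed_pmult:
  assumes "P \<in> indexed_pset I (carrier R)" and "i \<in> I"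
  shows "mpeval R (indexed_pmult P i) x = mpeval R P x \<otimes> x i"
proof -
  define S where "S = {m. P m \<noteq> \<zero>}"
  have S: "finite S"
    unfolding S_def by (rule indexed_pset_finite_support[OF assms(1)])
  have coeff: "P m \<in> carrier R" for m
    by (rule indexed_pset_coeff_closed[OF assms(1)])
  have val: "monomial_value R x m \<in> carrier R" if "m \<in> S" for m
    using that indexed_pset_monomial_value_closed[OF assms(1)] by (simp add: S_def)
  have xi: "x i \<in> carrier R"
    using x assms(2) by auto
  have val': "monomial_value R x (add_mset i m) = monomial_value R x m \<otimes> x i" if "m \<in> S" for m
    using that indexed_pset_support[OF assms(1), of m] x assms(2)
    by (intro monomial_value_add_mset) (auto simp: S_def)
  have Pi: "indexed_pmult P i \<in> indexed_pset I (carrier R)"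
    using assms by (rule indexed_pset.indexed_pmult)
  have "mpeval R (indexed_pmult P i) x =
      (\<Oplus>m \<in> add_mset i ` S. indexed_pmult P i m \<otimes> monomial_value R x m)"
  proof (rule mpeval_eq_finsum)
    show "{m. indexed_pmult P i m \<noteq> \<zero>} \<subseteq> add_mset i ` S"
    proof
      fix m assume "m \<in> {m. indexed_pmult P i m \<noteq> \<zero>}"
      then have "i \<in># m" "P (m - {#i#}) \<noteq> \<zero>"
        by (auto simp: indexed_pmult_def split: if_splits)
      then show "m \<in> add_mset i ` S"
        by (intro image_eqI[of _ _ "m - {#i#}"]) (auto simp: S_def)
    qed
  qed (use S val val' xi Pi indexed_pset_coeff_closed indexed_pset_monomial_value_closed in auto)
  also have "\<dots> = (\<Oplus>m \<in> S. indexed_pmult P i (add_mset i m) \<otimes> monomial_value R x (add_mset i m))"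
    using S coeff val val' xi by (intro finsum_reindex) (auto simp: indexed_pmult_def inj_on_def)
  also have "\<dots> = (\<Oplus>m \<in> S. P m \<otimes> monomial_value R x m \<otimes> x i)"
    using coeff val val' xi
    by (intro finsum_cong) (auto simp: indexed_pmult_def m_assoc simp_implies_def)
  also have "\<dots> = (\<Oplus>m \<in> S. P m \<otimes> monomial_value R x m) \<otimes> x i"
    using S coeff val xi by (intro finsum_ldistr[symmetric]) auto
  also have "\<dots> = mpeval R P x \<otimes> x i"
    unfolding S_def mpeval_def monomial_value_def ..
  finally show ?thesis .
qed

end

lemma mpeval_indexed_var:
  assumes "x i \<in> carrier R"
  shows "mpeval R (indexed_var i) x = x i"
proof -
  have "mpeval R (indexed_pmult (indexed_const \<one>) i) x = mpeval R (indexed_const \<one>) x \<otimes> x i"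
    using assms by (intro mpeval_indexed_pmult[of x "{i}"] indexed_pset.indexed_const) auto
  then show ?thesis
    using assms by (simp add: indexed_var_def mpeval_indexed_const)
qed

text \<open>The separant needed for the instance \<open>q = \<delta>(y)\<close> of (DL): being 1, it
  vanishes nowhere.\<close>

lemma mpderiv_indexed_var: "mpderiv R i (indexed_var i) = indexed_const \<one>"
  by (auto simp: mpderiv_def indexed_var_def indexed_pmult_def indexed_const_def fun_eq_iff)

end

section \<open>One variable: passage to coefficient lists and finiteness of zero sets\<close>

context
  fixes R :: "'a ring" (structure)
  assumes domain: "domain R"
begin

interpretation domain R
  by (rule domain)

text \<open>The three generators of \<open>indexed_pset\<close> correspond to constants, sums and
  multiplication by \<open>X\<close>, and \<open>eval\<close> at a point is a ring
  homomorphism.\<close>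

lemma indexed_pset_single_eval:
  assumes "P \<in> indexed_pset {i} (carrier R)"
  shows "\<exists>p \<in> carrier (poly_ring R). \<forall>x. x i \<in> carrier R \<longrightarrow> mpeval R P x = eval p (x i)"
  using assms
proof induction
  case (indexed_const k)
  interpret UP: ring_hom_ring R "poly_ring R" poly_of_const
    using canonical_embedding_ring_hom[OF carrier_is_subring] by simp
  have "eval (poly_of_const k) a = k" if "a \<in> carrier R" for a
    using indexed_const by (simp add: poly_of_const_def)
  then show ?case
    using indexed_const mpeval_indexed_const[OF cring_axioms] UP.hom_closed
    by (intro bexI[of _ "poly_of_const k"]) auto
next
  case (indexed_padd P Q)
  then obtain p q where pq: "p \<in> carrier (poly_ring R)" "q \<in> carrier (poly_ring R)"
    "\<And>x. x i \<in> carrier R \<Longrightarrow> mpeval R P x = eval p (x i)"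
    "\<And>x. x i \<in> carrier R \<Longrightarrow> mpeval R Q x = eval q (x i)"
    by blast
  show ?case
  proof (intro bexI allI impI)
    show "p \<oplus>\<^bsub>poly_ring R\<^esub> q \<in> carrier (poly_ring R)"
      using univ_poly_is_ring[OF carrier_is_subring] pq(1,2) by (rule ring.ring_simprules(1))
    fix x :: "nat \<Rightarrow> 'a" assume xi: "x i \<in> carrier R"
    then have "mpeval R (indexed_padd P Q) x = mpeval R P x \<oplus> mpeval R Q x"
      using indexed_padd.hyps by (intro mpeval_indexed_padd[OF cring_axioms]) auto
    then show "mpeval R (indexed_padd P Q) x = eval (p \<oplus>\<^bsub>poly_ring R\<^esub> q) (x i)"
      using pq xi ring_hom_add[OF eval_is_hom[OF carrier_is_subring xi]] by simp
  qed
next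
  case (indexed_pmult P j)
  then obtain p where p: "p \<in> carrier (poly_ring R)"
    "\<And>x. x i \<in> carrier R \<Longrightarrow> mpeval R P x = eval p (x i)"
    by blast
  have X: "X \<in> carrier (poly_ring R)"
    by (rule var_closed(1)[OF carrier_is_subring])
  show ?case
  proof (intro bexI allI impI)
    show "p \<otimes>\<^bsub>poly_ring R\<^esub> X \<in> carrier (poly_ring R)"
      using univ_poly_is_ring[OF carrier_is_subring] p(1) X by (rule ring.ring_simprules(5))
    fix x :: "nat \<Rightarrow> 'a" assume xi: "x i \<in> carrier R"
    then have "mpeval R (indexed_pmult P j) x = mpeval R P x \<otimes> x i"
      using indexed_pmult.hyps mpeval_indexed_pmult[OF cring_axioms, of x "{i}" P i] by auto
    then show "mpeval R (indexed_pmult P j) x = eval (p \<otimes>\<^bsub>poly_ring R\<^esub> X) (x i)"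
      using p X xi ring_hom_mult[OF eval_is_hom[OF carrier_is_subring xi]] eval_var by simp
  qed
qed

text \<open>The value depends on coordinate \<open>i\<close> only, so the quantifier over the
  remaining coordinates of \<open>x\<close> adds no zeros.\<close>

lemma indexed_pset_single_finite_zeros:
  assumes "P \<in> indexed_pset {i} (carrier R)" and "y i \<in> carrier R" and "mpeval R P y \<noteq> \<zero>"
  shows "finite {a \<in> carrier R. \<exists>x. x i = a \<and> mpeval R P x = \<zero>}"
proof -
  obtain p where p: "p \<in> carrier (poly_ring R)"
    "\<And>x. x i \<in> carrier R \<Longrightarrow> mpeval R P x = eval p (x i)"
    using indexed_pset_single_eval[OF assms(1)] by blast
  \<comment> \<open>The zero polynomial \<open>[]\<close> would vanish at
    \<open>y i\<close>.\<close>
  have "p \<noteq> []"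
    using p(2)[of y, OF assms(2)] assms(3) by auto
  then have "{a \<in> carrier R. \<exists>x. x i = a \<and> mpeval R P x = \<zero>} \<subseteq> {a. is_root p a}"
    using p(2) unfolding is_root_def by auto
  then show ?thesis
    using finite_number_of_roots[OF p(1)] finite_subset by blast
qed

end

section \<open>Fields with a derivation\<close>

locale field_derivation = field R for R (structure) +
  fixes d :: "'a \<Rightarrow> 'a"
  assumes d_closed: "x \<in> carrier R \<Longrightarrow> d x \<in> carrier R"
    and d_add: "\<lbrakk>x \<in> carrier R; y \<in> carrier R\<rbrakk> \<Longrightarrow> d (x \<oplus> y) = d x \<oplus> d y"
    and d_mult: "\<lbrakk>x \<in> carrier R; y \<in> carrier R\<rbrakk> \<Longrightarrow> d (x \<otimes> y) = d x \<otimes> y \<oplus> x \<otimes> d y"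
begin

definition constant_field :: "'a set" where
  "constant_field = {c \<in> carrier R. d c = \<zero>}"

lemma d_zero: "d \<zero> = \<zero>"
  using d_add[OF zero_closed zero_closed] d_closed[OF zero_closed] add.l_cancel_one by simp

lemma d_one: "d \<one> = \<zero>"
  using d_mult[OF one_closed one_closed] d_closed[OF one_closed] add.l_cancel_one by simp

text \<open>Differentiating the product of \<open>c\<close> and its inverse, which is 1, leaves only
  \<open>c \<otimes> d (inv c)\<close>.\<close>

lemma d_inv_const:
  assumes "c \<in> constant_field" and "c \<noteq> \<zero>"
  shows "d (inv c) = \<zero>"
proof -
  have c: "c \<in> carrier R" "d c = \<zero>" "c \<in> Units R"
    using assms by (auto simp: constant_field_def field_Units)
  have "d (c \<otimes> inv c) = \<zero> \<otimes> inv c \<oplus> c \<otimes> d (inv c)"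
    using d_mult[of c "inv c"] c by simp
  then have "c \<otimes> d (inv c) = \<zero>"
    using c d_closed[of "inv c"] by (simp add: d_one)
  then show ?thesis
    using c assms(2) d_closed[of "inv c"] integral by blast
qed

lemma subring_constant_field: "subring constant_field R"
proof (rule subringI)
  fix h assume h: "h \<in> constant_field"
  then have "d (h \<oplus> \<ominus> h) = d h \<oplus> d (\<ominus> h)"
    by (intro d_add) (auto simp: constant_field_def)
  then show "\<ominus> h \<in> constant_field"
    using h d_closed[of "\<ominus> h"] by (simp add: constant_field_def r_neg d_zero)
qed (auto simp: constant_field_def d_one d_add d_mult)

lemma subfield_constant_field: "subfield constant_field R"
  using subring_constant_field by (rule subfieldI') (auto simp: d_inv_const constant_field_def field_Units)

text \<open>For \<open>n = 0\<close> the truncated exponent \<open>n - 1\<close> is harmless,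
  because the coefficient \<open>[0]\<close> annihilates the term.\<close>

lemma d_pow:
  fixes n :: nat
  assumes "a \<in> carrier R"
  shows "d (a [^] n) = [n] \<cdot> (a [^] (n - 1)) \<otimes> d a"
proof (induction n)
  case 0
  then show ?case
    using assms d_closed by (simp add: d_one)
next
  case (Suc n)
  note da = d_closed[OF assms]
  have "[n] \<cdot> (a [^] (n - 1)) \<otimes> d a \<otimes> a = [n] \<cdot> (a [^] n) \<otimes> d a"
  proof (cases n)
    case (Suc k)
    then have k: "n - 1 = k" and pow: "a [^] n = a [^] k \<otimes> a"
      by auto
    show ?thesis
      unfolding k pow add_pow_ldistr[OF nat_pow_closed[OF assms] assms, symmetric]
      using assms da by (simp add: m_ac)
  qed (use assms da in simp)
  then show ?case
    using Suc.IH assms da by (simp add: d_mult l_distr)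
qed

end

text \<open>Lists begin with the leading coefficient, so \<open>length p\<close> is the exponent
  belonging to \<open>c\<close>. The constant term is dropped, and nothing is normalized: that the
  new head is nonzero needs characteristic 0 and is shown at the point of use.\<close>

fun (in ring) formal_deriv :: "'a list \<Rightarrow> 'a list" where
  "formal_deriv [] = []"
| "formal_deriv (c # p) = (if p = [] then [] else [length p] \<cdot> c # formal_deriv p)"

lemma (in ring) length_formal_deriv: "length (formal_deriv p) = length p - 1"
  by (induction p) auto

lemma (in ring) set_formal_deriv:
  assumes "subring K R" and "set p \<subseteq> K"
  shows "set (formal_deriv p) \<subseteq> K"
proof -
  have "[n] \<cdot> c \<in> K" if "c \<in> K" for c and n :: nat
    using that subringE(2,7)[OF assms(1)] by (induction n) auto
  then show ?thesis
    using assms(2) by (induction p) auto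
qed

text \<open>For \<open>p = []\<close> the coefficient \<open>[0]\<close> makes the extra term
  vanish, so the induction in \<open>d_eval\<close> needs no case split.\<close>

lemma (in ring) eval_formal_deriv_Cons:
  assumes "c \<in> carrier R" and "a \<in> carrier R" and "set p \<subseteq> carrier R"
  shows "eval (formal_deriv (c # p)) a =
    [length p] \<cdot> c \<otimes> a [^] (length p - 1) \<oplus> eval (formal_deriv p) a"
  using assms by (cases p) (auto simp: length_formal_deriv)

context field_derivation
begin

text \<open>The coefficients are constants, so the chain rule has no summand with differentiated
  coefficients.\<close>

lemma d_eval:
  assumes "set p \<subseteq> constant_field" and "a \<in> carrier R"
  shows "d (eval p a) = eval (formal_deriv p) a \<otimes> d a"
  using assms(1)
proof (induction p)
  case Nil
  then show ?case
    using assms d_closed by (simp add: d_zero)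
next
  case (Cons c p)
  then have c: "c \<in> carrier R" "d c = \<zero>" and p: "set p \<subseteq> constant_field" "set p \<subseteq> carrier R"
    by (auto simp: constant_field_def)
  have fp: "set (formal_deriv p) \<subseteq> carrier R"
    using set_formal_deriv[OF carrier_is_subring p(2)] .
  note da = d_closed[OF assms(2)]
  have "d (eval (c # p) a) = c \<otimes> d (a [^] length p) \<oplus> d (eval p a)"
    using c assms(2) eval_in_carrier[OF p(2) assms(2)] d_closed[of "a [^] length p"]
    by (simp add: d_add d_mult)
  also have "\<dots> = [length p] \<cdot> c \<otimes> a [^] (length p - 1) \<otimes> d a \<oplus> eval (formal_deriv p) a \<otimes> d a"
    using Cons.IH[OF p(1)] c assms(2) da
    by (simp add: d_pow m_assoc add_pow_ldistr add_pow_rdistr)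
  also have "\<dots> = eval (formal_deriv (c # p)) a \<otimes> d a"
    using c assms(2) da p(2) eval_in_carrier[OF fp assms(2)]
    by (simp only: eval_formal_deriv_Cons) (simp add: l_distr)
  finally show ?case .
qed

text \<open>If \<open>d a\<close> were nonzero, differentiating a shortest annihilating list would
  force \<open>a\<close> to be a root of the formal derivative, which is shorter and, in
  characteristic 0, still has a nonzero head.\<close>

lemma algebraic_over_constant_field:
  assumes char0: "\<And>n :: nat. 0 < n \<Longrightarrow> [n] \<cdot> \<one> \<noteq> \<zero>"
    and a: "a \<in> carrier R" "(algebraic over constant_field) a"
  shows "a \<in> constant_field"
proof (rule ccontr)
  assume "a \<notin> constant_field"
  then have da: "d a \<in> carrier R" "d a \<noteq> \<zero>"
    using a d_closed by (auto simp: constant_field_def)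
  define root where
    "root p \<longleftrightarrow> p \<noteq> [] \<and> set p \<subseteq> constant_field \<and> hd p \<noteq> \<zero> \<and> eval p a = \<zero>" for p
  obtain p where "p \<in> carrier (constant_field[X])" "p \<noteq> []" "eval p a = \<zero>"
    using algebraicE[OF subring_constant_field a] .
  then have "root p"
    unfolding root_def univ_poly_carrier[symmetric] polynomial_def by auto
  \<comment> \<open>Minimal length takes the place of irreducibility; \<open>root\<close> asks for a
    nonzero head, not for a monic polynomial.\<close>
  then obtain q where q: "root q" and min: "\<And>r. length r < length q \<Longrightarrow> \<not> root r"
    using ex_has_least_nat[of root p length] by (metis not_less)
  then obtain c q' where cq: "q = c # q'"
    unfolding root_def by (cases q) auto
  have c: "c \<in> constant_field" "c \<in> carrier R" "c \<noteq> \<zero>" and q': "set q' \<subseteq> constant_field" "set q' \<subseteq> carrier R"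
    using q unfolding cq root_def constant_field_def by auto
  \<comment> \<open>Otherwise the value at \<open>a\<close> would be the nonzero constant
    \<open>c\<close>. So the degree is positive, and its multiple of \<open>c\<close> can be
    nonzero.\<close>
  have "q' \<noteq> []"
    using q c unfolding cq root_def by auto
  have fq: "set (formal_deriv q) \<subseteq> constant_field"
    using set_formal_deriv[OF subring_constant_field] q by (simp add: root_def)
  then have "set (formal_deriv q) \<subseteq> carrier R"
    by (auto simp: constant_field_def)
  then have fqa: "eval (formal_deriv q) a \<in> carrier R"
    using eval_in_carrier a by blast
  have "eval (formal_deriv q) a \<otimes> d a = \<zero>"
    using q d_eval[of q a] a by (simp add: root_def d_zero)
  then have "eval (formal_deriv q) a = \<zero>"
    using integral fqa da by blast
  moreover have "[length q'] \<cdot> c \<noteq> \<zero>"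
  proof
    assume "[length q'] \<cdot> c = \<zero>"
    then have "([length q'] \<cdot> \<one>) \<otimes> c = \<zero>"
      using c by (simp add: add_pow_ldistr)
    then show False
      using char0[of "length q'"] \<open>q' \<noteq> []\<close> c integral by auto
  qed
  ultimately have "root (formal_deriv q)"
    using fq \<open>q' \<noteq> []\<close> unfolding root_def cq by auto
  then show False
    using min[of "formal_deriv q"] by (simp add: length_formal_deriv cq del: formal_deriv.simps)
qed

end


section \<open>Elementary substructures\<close>

lemma tm_val_restrict_univ: "tm_val (M\<lparr>univ := B\<rparr>) s t = tm_val M s t"
  by (induction t) (auto cong: map_cong)

lemma assigns_upd: "\<lbrakk>s \<in> assigns B; b \<in> B\<rbrakk> \<Longrightarrow> s(n := b) \<in> assigns B"
  by (simp add: assigns_def)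

lemma assigns_mono: "\<lbrakk>s \<in> assigns A; A \<subseteq> B\<rbrakk> \<Longrightarrow> s \<in> assigns B"
  by (auto simp: assigns_def)

text \<open>Truth is evaluated in \<open>M\<close> only, so the test makes sense before
  \<open>B\<close> is known to be a substructure; closure under function symbols is established
  separately.\<close>

definition tarski_vaught :: "('f, 'r) lang \<Rightarrow> ('a, 'f, 'r) struct \<Rightarrow> 'a set \<Rightarrow> bool" where
  "tarski_vaught L M B \<longleftrightarrow> B \<subseteq> univ M \<and>
     (\<forall>\<phi> \<in> formulas L. \<forall>s \<in> assigns B. \<forall>n. \<forall>a \<in> univ M. sat M (s(n := a)) \<phi> \<longrightarrow>
        (\<exists>b \<in> B. sat M (s(n := b)) \<phi>))"

lemma tarski_vaughtD:
  assumes "tarski_vaught L M B" and "\<phi> \<in> formulas L" and "s \<in> assigns B"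
    and "a \<in> univ M" and "sat M (s(n := a)) \<phi>"
  shows "\<exists>b \<in> B. sat M (s(n := b)) \<phi>"
  using assms unfolding tarski_vaught_def by blast

lemma sat_restrict_univ:
  assumes "tarski_vaught L M B" and "\<phi> \<in> formulas L" and "s \<in> assigns B"
  shows "sat (M\<lparr>univ := B\<rparr>) s \<phi> \<longleftrightarrow> sat M s \<phi>"
  using assms(2,3)
proof (induction \<phi> arbitrary: s)
  case (Ex n \<phi>)
  then have \<phi>: "\<phi> \<in> formulas L"
    by (simp add: formulas_def)
  have IH: "sat (M\<lparr>univ := B\<rparr>) (s(n := b)) \<phi> \<longleftrightarrow> sat M (s(n := b)) \<phi>" if "b \<in> B" for b
    using Ex.IH[OF \<phi> assigns_upd[OF Ex.prems(2) that]] .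
  have "sat (M\<lparr>univ := B\<rparr>) s (Ex n \<phi>) \<longleftrightarrow> (\<exists>b \<in> B. sat M (s(n := b)) \<phi>)"
    using IH by simp
  also have "\<dots> \<longleftrightarrow> (\<exists>a \<in> univ M. sat M (s(n := a)) \<phi>)"
    using assms(1) tarski_vaughtD[OF assms(1) \<phi> Ex.prems(2)] by (auto simp: tarski_vaught_def)
  finally show ?case
    by simp
next
  case (All n \<phi>)
  then have \<phi>: "\<phi> \<in> formulas L" and neg: "Neg \<phi> \<in> formulas L"
    by (simp_all add: formulas_def)
  \<comment> \<open>A counterexample to \<open>\<phi>\<close> is a witness for
    \<open>Neg \<phi>\<close>, so the test moves it into \<open>B\<close>.\<close>
  have counter: "\<exists>b \<in> B. \<not> sat M (s(n := b)) \<phi>" if "a \<in> univ M" "\<not> sat M (s(n := a)) \<phi>" for a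
    using tarski_vaughtD[OF assms(1) neg All.prems(2) that(1)] that(2) by simp
  have IH: "sat (M\<lparr>univ := B\<rparr>) (s(n := b)) \<phi> \<longleftrightarrow> sat M (s(n := b)) \<phi>" if "b \<in> B" for b
    using All.IH[OF \<phi> assigns_upd[OF All.prems(2) that]] .
  have "sat (M\<lparr>univ := B\<rparr>) s (All n \<phi>) \<longleftrightarrow> (\<forall>b \<in> B. sat M (s(n := b)) \<phi>)"
    using IH by simp
  also have "\<dots> \<longleftrightarrow> (\<forall>a \<in> univ M. sat M (s(n := a)) \<phi>)"
    using counter assms(1) unfolding tarski_vaught_def by blast
  finally show ?case
    by simp
qed (auto simp: tm_val_restrict_univ formulas_def cong: map_cong)

lemma tarski_vaught_elementary_substructure:
  assumes "is_struct L M" and "is_struct L (M\<lparr>univ := B\<rparr>)" and "tarski_vaught L M B"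
  shows "elementary_substructure L (M\<lparr>univ := B\<rparr>) M"
  using assms sat_restrict_univ[OF assms(3)]
  by (auto simp: elementary_substructure_def substructure_def tarski_vaught_def)

lemma models_elementary_substructure:
  assumes "elementary_substructure L M N" and "T \<subseteq> formulas L" and "models L T N"
  shows "models L T M"
  using assms assigns_mono[of _ "univ M" "univ N"]
  by (auto simp: models_def elementary_substructure_def substructure_def)


section \<open>Renaming variables\<close>

fun rename_tm :: "(nat \<Rightarrow> nat) \<Rightarrow> 'f tm \<Rightarrow> 'f tm" where
  "rename_tm \<pi> (Var i) = Var (\<pi> i)"
| "rename_tm \<pi> (Fn f ts) = Fn f (map (rename_tm \<pi>) ts)"

text \<open>The Tarski-Vaught test concerns an arbitrary variable \<open>n\<close>, while
  \<open>acl\<close> and the definable subsets of the line single out variable 0. A transposition of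
  variables mediates; bound variables are renamed too.\<close>

fun rename :: "(nat \<Rightarrow> nat) \<Rightarrow> ('f, 'r) fm \<Rightarrow> ('f, 'r) fm" where
  "rename \<pi> (Eq t u) = Eq (rename_tm \<pi> t) (rename_tm \<pi> u)"
| "rename \<pi> (Rel r ts) = Rel r (map (rename_tm \<pi>) ts)"
| "rename \<pi> (Neg \<phi>) = Neg (rename \<pi> \<phi>)"
| "rename \<pi> (And \<phi> \<psi>) = And (rename \<pi> \<phi>) (rename \<pi> \<psi>)"
| "rename \<pi> (Or \<phi> \<psi>) = Or (rename \<pi> \<phi>) (rename \<pi> \<psi>)"
| "rename \<pi> (Ex n \<phi>) = Ex (\<pi> n) (rename \<pi> \<phi>)"
| "rename \<pi> (All n \<phi>) = All (\<pi> n) (rename \<pi> \<phi>)"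

lemma tm_in_rename [simp]: "tm_in L (rename_tm \<pi> t) \<longleftrightarrow> tm_in L t"
  by (induction t) auto

lemma rename_formulas: "rename \<pi> \<phi> \<in> formulas L \<longleftrightarrow> \<phi> \<in> formulas L"
  unfolding formulas_def mem_Collect_eq by (induction \<phi>) auto

lemma tm_val_rename: "tm_val M s (rename_tm \<pi> t) = tm_val M (s \<circ> \<pi>) t"
  by (induction t) (auto simp: o_def cong: map_cong)

text \<open>Injectivity excludes capture: an update at \<open>\<pi> n\<close> is pulled back to an
  update at \<open>n\<close> alone.\<close>

lemma sat_rename:
  assumes "inj \<pi>"
  shows "sat M s (rename \<pi> \<phi>) \<longleftrightarrow> sat M (s \<circ> \<pi>) \<phi>"
proof -
  have upd: "s(\<pi> n := a) \<circ> \<pi> = (s \<circ> \<pi>)(n := a)" for s :: "nat \<Rightarrow> 'a" and n a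
    using assms by (auto simp: fun_eq_iff inj_eq)
  show ?thesis
  proof (induction \<phi> arbitrary: s)
    case (Rel r ts)
    have "map (tm_val M s) (map (rename_tm \<pi>) ts) = map (tm_val M (s \<circ> \<pi>)) ts"
      by (simp add: tm_val_rename)
    then show ?case
      by (simp only: rename.simps sat.simps)
  qed (simp_all add: tm_val_rename upd)
qed


section \<open>Types with respect to finitely many formulas\<close>

text \<open>\<open>\<psi>\<close> isolates the complete type over \<open>\<Theta>\<close> whose
  positive part is \<open>S\<close>. It is chosen before the structure, so one formula serves all
  fibres.\<close>

lemma finite_type_formula:
  assumes "finite \<Theta>" and "\<Theta> \<subseteq> formulas L"
  shows "\<exists>\<psi> \<in> formulas L. \<forall>(M :: ('a, 'f, 'r) struct) s.
    sat M s \<psi> \<longleftrightarrow> (\<forall>\<theta> \<in> \<Theta>. sat M s \<theta> \<longleftrightarrow> \<theta> \<in> S)"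
  using assms
proof induction
  case empty
  show ?case
    by (intro bexI[of _ "Eq (Var 0) (Var 0)"]) (auto simp: formulas_def)
next
  case (insert \<theta> \<Theta>)
  then obtain \<psi> where \<psi>: "\<psi> \<in> formulas L"
    "\<And>(M :: ('a, 'f, 'r) struct) s. sat M s \<psi> \<longleftrightarrow> (\<forall>\<theta> \<in> \<Theta>. sat M s \<theta> \<longleftrightarrow> \<theta> \<in> S)"
    by auto
  then show ?case
    using insert.prems
    by (intro bexI[of _ "And \<psi> (if \<theta> \<in> S then \<theta> else Neg \<theta>)"]) (auto simp: formulas_def)
qed


section \<open>Gluing over a Boolean space\<close>

lemma clopens_Int: "\<lbrakk>U \<in> clopens \<tau>; V \<in> clopens \<tau>\<rbrakk> \<Longrightarrow> U \<inter> V \<in> clopens \<tau>"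
  by (simp add: clopens_def openin_Int closedin_Int)

lemma clopens_iff_set:
  assumes "{x \<in> topspace \<tau>. p x} \<in> clopens \<tau>" and "{x \<in> topspace \<tau>. q x} \<in> clopens \<tau>"
  shows "{x \<in> topspace \<tau>. p x \<longleftrightarrow> q x} \<in> clopens \<tau>"
proof -
  let ?p = "{x \<in> topspace \<tau>. p x}" and ?q = "{x \<in> topspace \<tau>. q x}"
  have "{x \<in> topspace \<tau>. p x \<longleftrightarrow> q x} = (?p \<inter> ?q) \<union> (topspace \<tau> - (?p \<union> ?q))"
    by auto
  then show ?thesis
    using assms unfolding clopens_def
    by (auto simp: openin_Int openin_Un closedin_Int closedin_Un openin_diff closedin_diff)
qed

text \<open>The patchwork property for a bare set of sections, to be used both for all elements and
  for the constants.\<close>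

definition patches :: "'x topology \<Rightarrow> ('x \<Rightarrow> 'a) set \<Rightarrow> bool" where
  "patches \<tau> E \<longleftrightarrow> (\<forall>f \<in> E. \<forall>g \<in> E. \<forall>U \<in> clopens \<tau>. \<exists>h \<in> E.
     (\<forall>x \<in> U. f x = h x) \<and> (\<forall>x \<in> topspace \<tau> - U. g x = h x))"

text \<open>The finitely many clopen sets left by compactness need not be disjoint: adding one
  overrides the section glued so far on that set, where the new local solution is correct, and keeps
  it elsewhere. \<open>E \<noteq> {}\<close> starts the induction.\<close>

lemma patches_glue:
  assumes "compact_space \<tau>" and "patches \<tau> E" and "E \<noteq> {}"
    and loc: "\<And>x. x \<in> topspace \<tau> \<Longrightarrow> \<exists>e \<in> E. \<exists>V \<in> clopens \<tau>. x \<in> V \<and> (\<forall>y \<in> V. Q y (e y))"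
  shows "\<exists>e \<in> E. \<forall>x \<in> topspace \<tau>. Q x (e x)"
proof -
  define \<V> where "\<V> = {V \<in> clopens \<tau>. \<exists>e \<in> E. \<forall>y \<in> V. Q y (e y)}"
  have open_\<V>: "\<forall>V \<in> \<V>. openin \<tau> V"
    by (simp add: \<V>_def clopens_def)
  have "topspace \<tau> \<subseteq> \<Union>\<V>"
  proof
    fix x assume "x \<in> topspace \<tau>"
    then obtain e V where "e \<in> E" "V \<in> clopens \<tau>" "x \<in> V" "\<forall>y \<in> V. Q y (e y)"
      using loc by meson
    then show "x \<in> \<Union>\<V>"
      unfolding \<V>_def by (intro UnionI[of V]) auto
  qed
  then obtain \<F> where \<F>: "finite \<F>" "\<F> \<subseteq> \<V>" "topspace \<tau> \<subseteq> \<Union>\<F>"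
    using assms(1) open_\<V> unfolding compact_space_alt by meson
  have "\<exists>e \<in> E. \<forall>y \<in> \<Union>\<F>. Q y (e y)"
    using \<F>(1,2)
  proof induction
    case empty
    then show ?case
      using assms(3) by auto
  next
    case (insert V \<F>)
    then obtain e where e: "e \<in> E" "\<And>y. y \<in> \<Union>\<F> \<Longrightarrow> Q y (e y)"
      by auto
    obtain e' where e': "e' \<in> E" "\<And>y. y \<in> V \<Longrightarrow> Q y (e' y)"
      using insert.prems unfolding \<V>_def by auto
    have V: "V \<in> clopens \<tau>" and \<F>: "\<Union>\<F> \<subseteq> topspace \<tau>"
      using insert.prems openin_subset unfolding \<V>_def clopens_def by fastforce+
    obtain h where h: "h \<in> E" "\<And>x. x \<in> V \<Longrightarrow> e' x = h x"
      "\<And>x. x \<in> topspace \<tau> - V \<Longrightarrow> e x = h x"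
      using assms(2)[unfolded patches_def, rule_format, OF e'(1) e(1) V] by blast
    have "Q y (h y)" if "y \<in> \<Union>(insert V \<F>)" for y
    proof (cases "y \<in> V")
      case True
      then show ?thesis
        using e'(2)[OF True] h(2)[OF True] by simp
    next
      case False
      then have y: "y \<in> \<Union>\<F>" "y \<in> topspace \<tau> - V"
        using that \<F> by auto
      show ?thesis
        using e(2)[OF y(1)] h(3)[OF y(2)] by simp
    qed
    then show ?case
      using h(1) by blast
  qed
  then show ?thesis
    using \<F>(3) by blast
qed


section \<open>Formulas in Boolean products\<close>

lemma prod_of_sel [simp]:
  "univ (prod_of P) = elems P"
  "fn (prod_of P) f as = (\<lambda>x \<in> points P. fn (fiber P x) f (map (\<lambda>a. a x) as))"
  "rl (prod_of P) r as \<longleftrightarrow> (\<forall>x \<in> points P. rl (fiber P x) r (map (\<lambda>a. a x) as))"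
  by (simp_all add: prod_of_def)

lemma patchwork_iff_patches:
  fixes P :: "('x, 'a, 'f, 'r) bprod"
  shows "patchwork P (clopens (base P)) \<longleftrightarrow> patches (base P) (elems P)"
proof -
  have "U \<subseteq> points P" if "U \<in> clopens (base P)" for U
    using that by (simp add: clopens_def openin_subset)
  then have "(U \<subseteq> {x \<in> points P. f x = h x} \<and> points P - U \<subseteq> {x \<in> points P. g x = h x}) \<longleftrightarrow>
      (\<forall>x \<in> U. f x = h x) \<and> (\<forall>x \<in> points P - U. g x = h x)"
    if "U \<in> clopens (base P)" for U and f g h :: "'x \<Rightarrow> 'a"
    using that by (auto simp: subset_iff)
  then show ?thesis
    unfolding patchwork_def patches_def by (intro ball_cong refl bex_cong)
qed

lemma fun_upd_at: "(\<lambda>i. (s(n := a)) i x) = (\<lambda>i. s i x)(n := a x)"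
  by auto

locale boolean_product =
  fixes L :: "('f, 'r) lang" and \<K> :: "('a, 'f, 'r) struct \<Rightarrow> bool" and P :: "('x, 'a, 'f, 'r) bprod"
  assumes Gamma_e: "Gamma_e L \<K> P"
begin

lemma compact_base: "compact_space (base P)"
  using Gamma_e by (simp add: Gamma_e_def boolean_space_def)

lemma patches_elems: "patches (base P) (elems P)"
  using Gamma_e by (simp add: Gamma_e_def patchwork_iff_patches)

lemma elems_extensional: "f \<in> elems P \<Longrightarrow> f \<in> extensional (points P)"
  using Gamma_e by (auto simp: Gamma_e_def subdirect_product_def PiE_def)

lemma elems_at: "\<lbrakk>f \<in> elems P; x \<in> points P\<rbrakk> \<Longrightarrow> f x \<in> univ (fiber P x)"
  using Gamma_e by (auto simp: Gamma_e_def subdirect_product_def PiE_def)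

lemma elems_lift:
  assumes "x \<in> points P" and "a \<in> univ (fiber P x)"
  obtains f where "f \<in> elems P" and "f x = a"
proof -
  have "(\<lambda>f. f x) ` elems P = univ (fiber P x)"
    using assms(1) Gamma_e by (simp add: Gamma_e_def subdirect_product_def)
  then have "a \<in> (\<lambda>f. f x) ` elems P"
    using assms(2) by simp
  then obtain f where "f \<in> elems P" "a = f x"
    by (rule imageE)
  then show thesis
    using that[of f] by simp
qed

lemma is_struct_prod: "is_struct L (prod_of P)"
  using Gamma_e by (simp add: Gamma_e_def subdirect_product_def)

lemma elems_nonempty: "elems P \<noteq> {}"
  using is_struct_prod by (simp add: is_struct_def)

lemma truth_set_clopen:
  assumes "\<phi> \<in> formulas L" and "s \<in> assigns (elems P)"
  shows "truth_set P \<phi> s \<in> clopens (base P)"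
proof -
  have "truth_set P \<phi> s \<in> truth_sets L P"
    using assms unfolding truth_sets_def by blast
  then show ?thesis
    using Gamma_e unfolding Gamma_e_def by blast
qed

section \<open>Truth in the product as a function of truth sets\<close>

lemma tm_val_prod_of:
  assumes "s \<in> assigns (elems P)"
  shows "tm_val (prod_of P) s t = (\<lambda>x \<in> points P. tm_val (fiber P x) (\<lambda>i. s i x) t)"
proof (induction t)
  case (Var i)
  \<comment> \<open>The right-hand side is \<open>undefined\<close> off the base; extensionality
    gives the same for \<open>s i\<close>.\<close>
  have "s i \<in> extensional (points P)"
    using assms elems_extensional by (simp add: assigns_def)
  then show ?case
    by (simp add: extensional_restrict)
next
  case (Fn f ts)
  have eq: "map (\<lambda>a. a x) (map (tm_val (prod_of P) s) ts) = map (tm_val (fiber P x) (\<lambda>i. s i x)) ts"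
    if "x \<in> points P" for x
    using that Fn by auto
  show ?case
    unfolding tm_val.simps prod_of_sel by (rule restrict_ext) (simp only: eq)
qed

text \<open>The base case of the Feferman-Vaught argument: functions and relations of the product
  are coordinatewise.\<close>

lemma sat_prod_atomic:
  assumes "s \<in> assigns (elems P)"
  shows "sat (prod_of P) s (Eq t u) \<longleftrightarrow> truth_set P (Eq t u) s = points P"
    and "sat (prod_of P) s (Rel r ts) \<longleftrightarrow> truth_set P (Rel r ts) s = points P"
proof -
  have "sat (prod_of P) s (Eq t u) \<longleftrightarrow>
      (\<forall>x \<in> points P. tm_val (fiber P x) (\<lambda>i. s i x) t = tm_val (fiber P x) (\<lambda>i. s i x) u)"
    unfolding sat.simps tm_val_prod_of[OF assms] by (auto simp: fun_eq_iff restrict_def)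
  then show "sat (prod_of P) s (Eq t u) \<longleftrightarrow> truth_set P (Eq t u) s = points P"
    by (auto simp: truth_set_def)
  have "map (\<lambda>a. a x) (map (tm_val (prod_of P) s) ts) = map (tm_val (fiber P x) (\<lambda>i. s i x)) ts"
    if "x \<in> points P" for x
    using that by (simp add: tm_val_prod_of[OF assms])
  then show "sat (prod_of P) s (Rel r ts) \<longleftrightarrow> truth_set P (Rel r ts) s = points P"
    by (auto simp: truth_set_def simp del: map_map)
qed

text \<open>A choice of witnesses in the single fibres becomes one witness in \<open>E\<close>,
  which may be all elements or the constants. Two assignments are allowed so that a type can be
  copied from \<open>s\<close> to \<open>s'\<close>.\<close>

lemma realize_finite_type:
  assumes "E \<subseteq> elems P" and "E \<noteq> {}" and "patches (base P) E"
    and \<Theta>: "finite \<Theta>" "\<Theta> \<subseteq> formulas L"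
    and s: "s \<in> assigns (elems P)" "s' \<in> assigns (elems P)" "a \<in> elems P"
    and loc: "\<And>x. x \<in> points P \<Longrightarrow> \<exists>e \<in> E. \<forall>\<theta> \<in> \<Theta>.
      sat (fiber P x) ((\<lambda>i. s' i x)(n := e x)) \<theta> \<longleftrightarrow> sat (fiber P x) ((\<lambda>i. s i x)(n := a x)) \<theta>"
  shows "\<exists>e \<in> E. \<forall>\<theta> \<in> \<Theta>. truth_set P \<theta> (s'(n := e)) = truth_set P \<theta> (s(n := a))"
proof -
  define Q where "Q \<Psi> x b \<longleftrightarrow> (\<forall>\<theta> \<in> \<Psi>.
    sat (fiber P x) ((\<lambda>i. s' i x)(n := b)) \<theta> \<longleftrightarrow> sat (fiber P x) ((\<lambda>i. s i x)(n := a x)) \<theta>)" for \<Psi> x b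
  \<comment> \<open>Finiteness of \<open>\<Theta>\<close> enters here: the set is a finite
    intersection of sets on which two clopen conditions agree.\<close>
  have clopen: "{x \<in> points P. Q \<Theta> x (e x)} \<in> clopens (base P)" if "e \<in> E" for e
    using \<Theta>
  proof induction
    case empty
    then show ?case
      by (simp add: Q_def clopens_def)
  next
    case (insert \<theta> \<Psi>)
    have e: "e \<in> elems P"
      using that assms(1) by (rule rev_subsetD)
    have \<theta>: "\<theta> \<in> formulas L"
      using insert.prems by simp
    have "truth_set P \<theta> (s'(n := e)) \<in> clopens (base P)"
      "truth_set P \<theta> (s(n := a)) \<in> clopens (base P)"
      using truth_set_clopen[OF \<theta> assigns_upd[OF s(2) e]] truth_set_clopen[OF \<theta> assigns_upd[OF s(1,3)]]
      by simp_all
    then have "{x \<in> points P. sat (fiber P x) ((\<lambda>i. s' i x)(n := e x)) \<theta> \<longleftrightarrow>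
        sat (fiber P x) ((\<lambda>i. s i x)(n := a x)) \<theta>} \<inter> {x \<in> points P. Q \<Psi> x (e x)} \<in> clopens (base P)"
      using insert.IH insert.prems unfolding truth_set_def fun_upd_at
      by (intro clopens_Int clopens_iff_set) simp_all
    also have "{x \<in> points P. sat (fiber P x) ((\<lambda>i. s' i x)(n := e x)) \<theta> \<longleftrightarrow>
        sat (fiber P x) ((\<lambda>i. s i x)(n := a x)) \<theta>} \<inter> {x \<in> points P. Q \<Psi> x (e x)} =
        {x \<in> points P. Q (insert \<theta> \<Psi>) x (e x)}"
      by (auto simp: Q_def)
    finally show ?case .
  qed
  have "\<exists>e \<in> E. \<forall>x \<in> points P. Q \<Theta> x (e x)"
  proof (rule patches_glue[OF compact_base assms(3,2)])
    fix x assume x: "x \<in> points P"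
    then obtain e where e: "e \<in> E" "Q \<Theta> x (e x)"
      using loc unfolding Q_def by blast
    then show "\<exists>e \<in> E. \<exists>V \<in> clopens (base P). x \<in> V \<and> (\<forall>y \<in> V. Q \<Theta> y (e y))"
      using clopen[OF e(1)] x by (intro bexI[of _ e] bexI[of _ "{x \<in> points P. Q \<Theta> x (e x)}"]) auto
  qed
  then show ?thesis
    unfolding Q_def truth_set_def fun_upd_at by blast
qed

text \<open>The induction step of a Feferman-Vaught argument: \<open>\<Theta>'\<close> consists of the formulas saying that
  a complete type over \<open>\<Theta>\<close> is realized.\<close>

lemma extend_truth_sets:
  assumes \<Theta>: "finite \<Theta>" "\<Theta> \<subseteq> formulas L"
  obtains \<Theta>' where "finite \<Theta>'" and "\<Theta>' \<subseteq> formulas L"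
    and "\<And>s s' a. \<lbrakk>s \<in> assigns (elems P); s' \<in> assigns (elems P); a \<in> elems P;
        \<And>\<theta>. \<theta> \<in> \<Theta>' \<Longrightarrow> truth_set P \<theta> s = truth_set P \<theta> s'\<rbrakk> \<Longrightarrow>
      \<exists>a' \<in> elems P. \<forall>\<theta> \<in> \<Theta>. truth_set P \<theta> (s'(n := a')) = truth_set P \<theta> (s(n := a))"
proof -
  have "\<forall>S. \<exists>\<psi>. \<psi> \<in> formulas L \<and> (\<forall>(M :: ('a, 'f, 'r) struct) s.
      sat M s \<psi> \<longleftrightarrow> (\<forall>\<theta> \<in> \<Theta>. sat M s \<theta> \<longleftrightarrow> \<theta> \<in> S))"
    using finite_type_formula[OF \<Theta>] by blast
  then obtain \<psi> where \<psi>: "\<And>S. \<psi> S \<in> formulas L" "\<And>S (M :: ('a, 'f, 'r) struct) s.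
      sat M s (\<psi> S) \<longleftrightarrow> (\<forall>\<theta> \<in> \<Theta>. sat M s \<theta> \<longleftrightarrow> \<theta> \<in> S)"
    by metis
  \<comment> \<open>One formula for each possible positive part, hence only finitely many.\<close>
  define \<Theta>' where "\<Theta>' = (\<lambda>S. Ex n (\<psi> S)) ` Pow \<Theta>"
  show thesis
  proof (rule that)
    show "finite \<Theta>'" "\<Theta>' \<subseteq> formulas L"
      using \<Theta>(1) \<psi>(1) by (auto simp: \<Theta>'_def formulas_def)
    fix s s' a
    assume s: "s \<in> assigns (elems P)" "s' \<in> assigns (elems P)" "a \<in> elems P"
      and agree: "\<And>\<theta>. \<theta> \<in> \<Theta>' \<Longrightarrow> truth_set P \<theta> s = truth_set P \<theta> s'"
    show "\<exists>a' \<in> elems P. \<forall>\<theta> \<in> \<Theta>. truth_set P \<theta> (s'(n := a')) = truth_set P \<theta> (s(n := a))"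
    proof (rule realize_finite_type[OF subset_refl elems_nonempty patches_elems \<Theta> s])
      fix x assume x: "x \<in> points P"
      \<comment> \<open>The type of \<open>a x\<close> over \<open>s\<close> in this fibre. That it
        is realized is visible in a truth set of \<open>s\<close>, hence in the same truth set of
        \<open>s'\<close>.\<close>
      define S where "S = {\<theta> \<in> \<Theta>. sat (fiber P x) ((\<lambda>i. s i x)(n := a x)) \<theta>}"
      have "x \<in> truth_set P (Ex n (\<psi> S)) s"
        using x elems_at[OF s(3) x] by (auto simp: truth_set_def \<psi>(2) S_def)
      moreover have "Ex n (\<psi> S) \<in> \<Theta>'"
        by (auto simp: \<Theta>'_def S_def)
      ultimately have "x \<in> truth_set P (Ex n (\<psi> S)) s'"
        using agree by blast
      then obtain b where b: "b \<in> univ (fiber P x)" "sat (fiber P x) ((\<lambda>i. s' i x)(n := b)) (\<psi> S)"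
        by (auto simp: truth_set_def)
      obtain e where "e \<in> elems P" "e x = b"
        using elems_lift[OF x b(1)] .
      then show "\<exists>e \<in> elems P. \<forall>\<theta> \<in> \<Theta>. sat (fiber P x) ((\<lambda>i. s' i x)(n := e x)) \<theta> \<longleftrightarrow>
          sat (fiber P x) ((\<lambda>i. s i x)(n := a x)) \<theta>"
        using b(2) by (intro bexI[of _ e]) (auto simp: \<psi>(2) S_def)
    qed
  qed
qed

text \<open>The invariance contained in the Feferman-Vaught theorem: truth in the product is a
  function of the truth sets of \<open>\<Theta>\<close>. The function itself, classically a formula
  about Boolean algebras, stays implicit.\<close>

definition determines :: "('f, 'r) fm set \<Rightarrow> ('f, 'r) fm \<Rightarrow> bool" where
  "determines \<Theta> \<phi> \<longleftrightarrow> (\<forall>s \<in> assigns (elems P). \<forall>s' \<in> assigns (elems P).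
     (\<forall>\<theta> \<in> \<Theta>. truth_set P \<theta> s = truth_set P \<theta> s') \<longrightarrow>
     (sat (prod_of P) s \<phi> \<longleftrightarrow> sat (prod_of P) s' \<phi>))"

text \<open>Having the same truth sets is a symmetric relation, so one implication suffices.\<close>

lemma determinesI:
  assumes "\<And>s s'. \<lbrakk>s \<in> assigns (elems P); s' \<in> assigns (elems P);
      \<And>\<theta>. \<theta> \<in> \<Theta> \<Longrightarrow> truth_set P \<theta> s = truth_set P \<theta> s'; sat (prod_of P) s \<phi>\<rbrakk> \<Longrightarrow>
    sat (prod_of P) s' \<phi>"
  shows "determines \<Theta> \<phi>"
  unfolding determines_def
proof (intro ballI impI iffI)
  fix s s' assume s: "s \<in> assigns (elems P)" "s' \<in> assigns (elems P)"
    and agree: "\<forall>\<theta> \<in> \<Theta>. truth_set P \<theta> s = truth_set P \<theta> s'"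
  show "sat (prod_of P) s' \<phi>" if "sat (prod_of P) s \<phi>"
    using assms[OF s] agree that by simp
  show "sat (prod_of P) s \<phi>" if "sat (prod_of P) s' \<phi>"
    using assms[OF s(2,1)] agree that by simp
qed

lemma determinesD:
  assumes "determines \<Theta> \<phi>" and "s \<in> assigns (elems P)" and "s' \<in> assigns (elems P)"
    and "\<forall>\<theta> \<in> \<Theta>. truth_set P \<theta> s = truth_set P \<theta> s'"
  shows "sat (prod_of P) s \<phi> \<longleftrightarrow> sat (prod_of P) s' \<phi>"
  using assms(1)[unfolded determines_def, rule_format, OF assms(2,3)] assms(4) by blast

text \<open>An atomic formula determines itself, connectives take unions, and a quantifier is
  absorbed by \<open>extend_truth_sets\<close>.\<close>

lemma finite_determining_set:
  assumes "\<phi> \<in> formulas L"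
  shows "\<exists>\<Theta>. finite \<Theta> \<and> \<Theta> \<subseteq> formulas L \<and> determines \<Theta> \<phi>"
  using assms
proof (induction \<phi>)
  case (Eq t u)
  then show ?case
    using sat_prod_atomic(1)
    by (intro exI[of _ "{Eq t u}"]) (simp add: determines_def del: sat.simps)
next
  case (Rel r ts)
  then show ?case
    using sat_prod_atomic(2)
    by (intro exI[of _ "{Rel r ts}"]) (simp add: determines_def del: sat.simps)
next
  case (Neg \<phi>)
  then obtain \<Theta> where \<Theta>: "finite \<Theta>" "\<Theta> \<subseteq> formulas L" "determines \<Theta> \<phi>"
    by (auto simp: formulas_def)
  have "determines \<Theta> (Neg \<phi>)"
  proof (rule determinesI)
    fix s s' assume s: "s \<in> assigns (elems P)" "s' \<in> assigns (elems P)"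
      "\<And>\<theta>. \<theta> \<in> \<Theta> \<Longrightarrow> truth_set P \<theta> s = truth_set P \<theta> s'" "sat (prod_of P) s (Neg \<phi>)"
    then show "sat (prod_of P) s' (Neg \<phi>)"
      using determinesD[OF \<Theta>(3) s(1,2)] by simp
  qed
  then show ?case
    using \<Theta>(1,2) by blast
next
  case (And \<phi> \<psi>)
  then obtain \<Theta> \<Theta>' where \<Theta>: "finite \<Theta>" "\<Theta> \<subseteq> formulas L" "determines \<Theta> \<phi>"
    and \<Theta>': "finite \<Theta>'" "\<Theta>' \<subseteq> formulas L" "determines \<Theta>' \<psi>"
    by (auto simp: formulas_def)
  have "determines (\<Theta> \<union> \<Theta>') (And \<phi> \<psi>)"
  proof (rule determinesI)
    fix s s' assume s: "s \<in> assigns (elems P)" "s' \<in> assigns (elems P)"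
      "\<And>\<theta>. \<theta> \<in> \<Theta> \<union> \<Theta>' \<Longrightarrow> truth_set P \<theta> s = truth_set P \<theta> s'" "sat (prod_of P) s (And \<phi> \<psi>)"
    then show "sat (prod_of P) s' (And \<phi> \<psi>)"
      using determinesD[OF \<Theta>(3) s(1,2)] determinesD[OF \<Theta>'(3) s(1,2)] by simp
  qed
  then show ?case
    using \<Theta>(1,2) \<Theta>'(1,2) by (intro exI[of _ "\<Theta> \<union> \<Theta>'"]) simp
next
  case (Or \<phi> \<psi>)
  then obtain \<Theta> \<Theta>' where \<Theta>: "finite \<Theta>" "\<Theta> \<subseteq> formulas L" "determines \<Theta> \<phi>"
    and \<Theta>': "finite \<Theta>'" "\<Theta>' \<subseteq> formulas L" "determines \<Theta>' \<psi>"
    by (auto simp: formulas_def)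
  have "determines (\<Theta> \<union> \<Theta>') (Or \<phi> \<psi>)"
  proof (rule determinesI)
    fix s s' assume s: "s \<in> assigns (elems P)" "s' \<in> assigns (elems P)"
      "\<And>\<theta>. \<theta> \<in> \<Theta> \<union> \<Theta>' \<Longrightarrow> truth_set P \<theta> s = truth_set P \<theta> s'" "sat (prod_of P) s (Or \<phi> \<psi>)"
    then show "sat (prod_of P) s' (Or \<phi> \<psi>)"
      using determinesD[OF \<Theta>(3) s(1,2)] determinesD[OF \<Theta>'(3) s(1,2)] by simp
  qed
  then show ?case
    using \<Theta>(1,2) \<Theta>'(1,2) by (intro exI[of _ "\<Theta> \<union> \<Theta>'"]) simp
next
  case (Ex n \<phi>)
  then obtain \<Theta> where \<Theta>: "finite \<Theta>" "\<Theta> \<subseteq> formulas L" "determines \<Theta> \<phi>"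
    by (auto simp: formulas_def)
  obtain \<Theta>' where \<Theta>': "finite \<Theta>'" "\<Theta>' \<subseteq> formulas L"
    and ext: "\<And>s s' a. \<lbrakk>s \<in> assigns (elems P); s' \<in> assigns (elems P); a \<in> elems P;
        \<And>\<theta>. \<theta> \<in> \<Theta>' \<Longrightarrow> truth_set P \<theta> s = truth_set P \<theta> s'\<rbrakk> \<Longrightarrow>
      \<exists>a' \<in> elems P. \<forall>\<theta> \<in> \<Theta>. truth_set P \<theta> (s'(n := a')) = truth_set P \<theta> (s(n := a))"
    using extend_truth_sets[OF \<Theta>(1,2)] by metis
  have "determines \<Theta>' (Ex n \<phi>)"
  proof (rule determinesI)
    fix s s' assume s: "s \<in> assigns (elems P)" "s' \<in> assigns (elems P)"
      "\<And>\<theta>. \<theta> \<in> \<Theta>' \<Longrightarrow> truth_set P \<theta> s = truth_set P \<theta> s'" "sat (prod_of P) s (Ex n \<phi>)"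
    obtain a where a: "a \<in> elems P" "sat (prod_of P) (s(n := a)) \<phi>"
      using s(4) by auto
    then obtain a' where a': "a' \<in> elems P"
      "\<forall>\<theta> \<in> \<Theta>. truth_set P \<theta> (s'(n := a')) = truth_set P \<theta> (s(n := a))"
      using ext[OF s(1,2) a(1) s(3)] by blast
    then show "sat (prod_of P) s' (Ex n \<phi>)"
      using a(2) determinesD[OF \<Theta>(3) assigns_upd[OF s(2) a'(1)] assigns_upd[OF s(1) a(1)] a'(2)]
      by auto
  qed
  then show ?case
    using \<Theta>' by blast
next
  case (All n \<phi>)
  then obtain \<Theta> where \<Theta>: "finite \<Theta>" "\<Theta> \<subseteq> formulas L" "determines \<Theta> \<phi>"
    by (auto simp: formulas_def)
  obtain \<Theta>' where \<Theta>': "finite \<Theta>'" "\<Theta>' \<subseteq> formulas L"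
    and ext: "\<And>s s' a. \<lbrakk>s \<in> assigns (elems P); s' \<in> assigns (elems P); a \<in> elems P;
        \<And>\<theta>. \<theta> \<in> \<Theta>' \<Longrightarrow> truth_set P \<theta> s = truth_set P \<theta> s'\<rbrakk> \<Longrightarrow>
      \<exists>a' \<in> elems P. \<forall>\<theta> \<in> \<Theta>. truth_set P \<theta> (s'(n := a')) = truth_set P \<theta> (s(n := a))"
    using extend_truth_sets[OF \<Theta>(1,2)] by metis
  have "determines \<Theta>' (All n \<phi>)"
  proof (rule determinesI)
    fix s s' assume s: "s \<in> assigns (elems P)" "s' \<in> assigns (elems P)"
      "\<And>\<theta>. \<theta> \<in> \<Theta>' \<Longrightarrow> truth_set P \<theta> s = truth_set P \<theta> s'" "sat (prod_of P) s (All n \<phi>)"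
    have "sat (prod_of P) (s'(n := a)) \<phi>" if a: "a \<in> elems P" for a
    proof -
      \<comment> \<open>The roles are exchanged: a challenge \<open>a\<close> for \<open>s'\<close>
        is matched by some \<open>a'\<close> for \<open>s\<close>, where the universal statement is
        known.\<close>
      obtain a' where a': "a' \<in> elems P"
        "\<forall>\<theta> \<in> \<Theta>. truth_set P \<theta> (s(n := a')) = truth_set P \<theta> (s'(n := a))"
        using ext[OF s(2,1) a s(3)[symmetric]] by blast
      have "sat (prod_of P) (s(n := a')) \<phi>"
        using s(4) a'(1) by simp
      then show ?thesis
        using determinesD[OF \<Theta>(3) assigns_upd[OF s(1) a'(1)] assigns_upd[OF s(2) a] a'(2)] by blast
    qed
    then show "sat (prod_of P) s' (All n \<phi>)"
      by simp
  qed
  then show ?case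
    using \<Theta>' by blast
qed

text \<open>Truth of \<open>\<phi>\<close> in the product is not local, so the test in the fibres is
  applied not to \<open>\<phi>\<close> but to the formulas isolating types over a determining
  set.\<close>

lemma tarski_vaught_prod:
  assumes D: "D \<subseteq> elems P" "D \<noteq> {}" "patches (base P) D"
    and fibers: "\<And>x. x \<in> points P \<Longrightarrow> tarski_vaught L (fiber P x) ((\<lambda>d. d x) ` D)"
  shows "tarski_vaught L (prod_of P) D"
  unfolding tarski_vaught_def
proof (intro conjI ballI allI impI)
  show "D \<subseteq> univ (prod_of P)"
    using D by simp
  fix \<phi> s n a
  assume \<phi>: "\<phi> \<in> formulas L" and sD: "s \<in> assigns D" and "a \<in> univ (prod_of P)"
    and sat: "sat (prod_of P) (s(n := a)) \<phi>"
  then have a: "a \<in> elems P"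
    by simp
  have s: "s \<in> assigns (elems P)"
    using sD D(1) by (rule assigns_mono)
  obtain \<Theta> where \<Theta>: "finite \<Theta>" "\<Theta> \<subseteq> formulas L" "determines \<Theta> \<phi>"
    using finite_determining_set[OF \<phi>] by blast
  have "\<exists>d \<in> D. \<forall>\<theta> \<in> \<Theta>. truth_set P \<theta> (s(n := d)) = truth_set P \<theta> (s(n := a))"
  proof (rule realize_finite_type[OF D \<Theta>(1,2) s s a])
    fix x assume x: "x \<in> points P"
    define S where "S = {\<theta> \<in> \<Theta>. sat (fiber P x) ((\<lambda>i. s i x)(n := a x)) \<theta>}"
    obtain \<psi> where \<psi>: "\<psi> \<in> formulas L" "\<And>(M :: ('a, 'f, 'r) struct) s.
        sat M s \<psi> \<longleftrightarrow> (\<forall>\<theta> \<in> \<Theta>. sat M s \<theta> \<longleftrightarrow> \<theta> \<in> S)"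
      using finite_type_formula[OF \<Theta>(1,2)] by blast
    have "(\<lambda>i. s i x) \<in> assigns ((\<lambda>d. d x) ` D)"
      using sD by (simp add: assigns_def)
    moreover have "sat (fiber P x) ((\<lambda>i. s i x)(n := a x)) \<psi>"
      by (simp add: \<psi>(2) S_def)
    ultimately obtain d where "d \<in> D" "sat (fiber P x) ((\<lambda>i. s i x)(n := d x)) \<psi>"
      using tarski_vaughtD[OF fibers[OF x] \<psi>(1)] elems_at[OF a x] by blast
    then show "\<exists>d \<in> D. \<forall>\<theta> \<in> \<Theta>. sat (fiber P x) ((\<lambda>i. s i x)(n := d x)) \<theta> \<longleftrightarrow>
        sat (fiber P x) ((\<lambda>i. s i x)(n := a x)) \<theta>"
      by (intro bexI[of _ d]) (auto simp: \<psi>(2) S_def)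
  qed
  then obtain d where d: "d \<in> D" "\<forall>\<theta> \<in> \<Theta>. truth_set P \<theta> (s(n := d)) = truth_set P \<theta> (s(n := a))"
    by blast
  have "d \<in> elems P"
    using d(1) D(1) by (rule rev_subsetD)
  then have "sat (prod_of P) (s(n := d)) \<phi>"
    using determinesD[OF \<Theta>(3) assigns_upd[OF s] assigns_upd[OF s a] d(2)] sat by simp
  then show "\<exists>d \<in> D. sat (prod_of P) (s(n := d)) \<phi>"
    using d(1) by blast
qed

text \<open>On the left quantifiers range over the smaller fibres; the test in every fibre says that
  this does not change truth.\<close>

lemma truth_set_sub_bprod:
  assumes "\<And>x. x \<in> points P \<Longrightarrow> tarski_vaught L (fiber P x) ((\<lambda>d. d x) ` D)"
    and "\<phi> \<in> formulas L" and "s \<in> assigns D"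
  shows "truth_set (sub_bprod P D) \<phi> s = truth_set P \<phi> s"
proof -
  have "(\<lambda>i. s i x) \<in> assigns ((\<lambda>d. d x) ` D)" for x
    using assms(3) by (simp add: assigns_def)
  then show ?thesis
    using sat_restrict_univ[OF assms(1,2)] by (auto simp: truth_set_def sub_bprod_def)
qed

end


section \<open>The constants of a generic derivation\<close>

text \<open>\<open>topology\<close> returns the intended open sets only for a predicate satisfying
  \<open>istopology\<close>; closure under binary intersections is where \<open>\<B>\<close> has to
  be directed downwards.\<close>

lemma openin_translation_topology:
  assumes "\<And>V W. \<lbrakk>V \<in> \<B>; W \<in> \<B>\<rbrakk> \<Longrightarrow> \<exists>N \<in> \<B>. N \<subseteq> V \<inter> W"
  shows "openin (translation_topology K \<B>) U \<longleftrightarrow>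
    U \<subseteq> univ K \<and> (\<forall>a \<in> U. \<exists>V \<in> \<B>. (\<lambda>y. fn K FAdd [a, y]) ` V \<subseteq> U)"
proof -
  let ?op = "\<lambda>U. U \<subseteq> univ K \<and> (\<forall>a \<in> U. \<exists>V \<in> \<B>. (\<lambda>y. fn K FAdd [a, y]) ` V \<subseteq> U)"
  have "istopology ?op"
    unfolding istopology_def
  proof (intro conjI allI impI ballI)
    fix S T a assume ST: "?op S" "?op T" and a: "a \<in> S \<inter> T"
    obtain V where V: "V \<in> \<B>" and VS: "(\<lambda>y. fn K FAdd [a, y]) ` V \<subseteq> S"
      using conjunct2[OF ST(1), rule_format, OF IntD1[OF a]] ..
    obtain W where W: "W \<in> \<B>" and WT: "(\<lambda>y. fn K FAdd [a, y]) ` W \<subseteq> T"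
      using conjunct2[OF ST(2), rule_format, OF IntD2[OF a]] ..
    obtain N where "N \<in> \<B>" "N \<subseteq> V \<inter> W"
      using assms[OF V W] by (rule bexE)
    then show "\<exists>N \<in> \<B>. (\<lambda>y. fn K FAdd [a, y]) ` N \<subseteq> S \<inter> T"
      using VS WT by (intro bexI[of _ N]) (auto simp: image_subset_iff)
  next
    fix \<S> a assume \<S>: "\<forall>S \<in> \<S>. ?op S" and "a \<in> \<Union>\<S>"
    then obtain S where "S \<in> \<S>" "a \<in> S"
      by blast
    then obtain V where "V \<in> \<B>" "(\<lambda>y. fn K FAdd [a, y]) ` V \<subseteq> S"
      using \<S> by blast
    then show "\<exists>V \<in> \<B>. (\<lambda>y. fn K FAdd [a, y]) ` V \<subseteq> \<Union>\<S>"
      using \<open>S \<in> \<S>\<close> by blast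
  qed blast+
  then show ?thesis
    by (simp add: translation_topology_def)
qed

text \<open>Only intersections of open sets are used, available for any value of type
  \<open>topology\<close>. So this applies to \<open>def_top\<close> before its open sets are
  described, without a circle.\<close>

lemma zero_basis_filter_base:
  assumes "zero_basis K \<tau> \<B>" and "V \<in> \<B>" and "W \<in> \<B>"
  shows "\<exists>N \<in> \<B>. N \<subseteq> V \<inter> W"
proof -
  obtain V' where V': "openin \<tau> V'" "fn K FZero [] \<in> V'" "V' \<subseteq> V"
    using assms(1,2) unfolding zero_basis_def by meson
  obtain W' where W': "openin \<tau> W'" "fn K FZero [] \<in> W'" "W' \<subseteq> W"
    using assms(1,3) unfolding zero_basis_def by meson
  have "openin \<tau> (V' \<inter> W')" "fn K FZero [] \<in> V' \<inter> W'"
    using V' W' by auto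
  then obtain N where "N \<in> \<B>" "N \<subseteq> V' \<inter> W'"
    using assms(1) unfolding zero_basis_def by meson
  then show ?thesis
    using V'(3) W'(3) by blast
qed

lemma ring_of_sel [simp]:
  "carrier (ring_of K) = univ K"
  "x \<otimes>\<^bsub>ring_of K\<^esub> y = fn K FMul [x, y]"
  "\<one>\<^bsub>ring_of K\<^esub> = fn K FOne []"
  "\<zero>\<^bsub>ring_of K\<^esub> = fn K FZero []"
  "x \<oplus>\<^bsub>ring_of K\<^esub> y = fn K FAdd [x, y]"
  by (simp_all add: ring_of_def)

section \<open>The constants of a single field\<close>

definition constant_elems :: "('a, 'c fsym, 'r) struct \<Rightarrow> 'a set" where
  "constant_elems K = {c \<in> univ K. fn K FDelta [c] = fn K FZero []}"

lemma field_derivation_ring_of: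
  assumes "field_struct K" and "derivation K"
    and "\<And>x. x \<in> univ K \<Longrightarrow> fn K FDelta [x] \<in> univ K"
  shows "field_derivation (ring_of K) (\<lambda>x. fn K FDelta [x])"
  using assms
  by (simp add: field_struct_def derivation_def field_derivation_def field_derivation_axioms_def)

lemma constant_field_ring_of:
  assumes "field_derivation (ring_of K) (\<lambda>x. fn K FDelta [x])"
  shows "field_derivation.constant_field (ring_of K) (\<lambda>x. fn K FDelta [x]) = constant_elems K"
  using assms by (simp add: field_derivation.constant_field_def constant_elems_def)

text \<open>A derivation may be nonzero at an element named by a constant symbol. The last
  assumption excludes this; it makes the constants an \<open>L\<close>-substructure and keeps
  \<open>acl\<close> over them a closure over a field of constants.\<close>

locale generic_field =
  fixes L :: "('c fsym, 'r) lang" and \<chi> :: "('c fsym, 'r) fm" and T :: "('c fsym, 'r) fm set"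
    and K :: "('a, 'c fsym, 'r) struct"
  assumes lang: "field_language L"
    and open_T: "open_theory TYPE('a) L \<chi> T"
    and acl_T: "acl_is_algebraic_closure TYPE('a) L T"
    and K: "models_T_delta_star L \<chi> T K"
    and const_values: "const_values L K \<subseteq> constant_elems K"
begin

lemma models_T: "models L T K"
  using K by (simp add: models_T_delta_star_def models_T_delta_def)

lemma fn_closed:
  assumes "f \<in> funs L \<or> f = FDelta" and "length as = fsym_ar f" and "set as \<subseteq> univ K"
  shows "fn K f as \<in> univ K"
  using K lang assms
  unfolding models_T_delta_star_def models_T_delta_def is_struct_def lang_delta_def field_language_def
  by auto

lemma open_theory_K:
  "field_struct K" "char_zero K" "zero_basis K (def_top \<chi> K) (chi_basis \<chi> K)"
  "field_topology K (def_top \<chi> K)"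
  using open_T models_T by (simp_all add: open_theory_def)

lemma definable_decomposition:
  assumes "S \<in> definable_sets L K n"
  obtains m :: nat and Z U where "\<And>i. i < m \<Longrightarrow> zariski_closed K n (Z i)"
    and "\<And>i. i < m \<Longrightarrow> openin (def_top_power \<chi> K n) (U i)" and "S = (\<Union>i < m. Z i \<inter> U i)"
proof -
  have "\<exists>m :: nat. \<exists>Z U. (\<forall>i < m. zariski_closed K n (Z i) \<and> U i \<in> definable_sets L K n \<and>
      openin (def_top_power \<chi> K n) (U i)) \<and> S = (\<Union>i < m. Z i \<inter> U i)"
    using open_T models_T assms unfolding open_theory_def by simp
  then obtain m :: nat and Z U where "\<forall>i < m. zariski_closed K n (Z i) \<and>
      U i \<in> definable_sets L K n \<and> openin (def_top_power \<chi> K n) (U i)"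
    "S = (\<Union>i < m. Z i \<inter> U i)"
    by (elim exE conjE)
  then show thesis
    by (intro that[of m Z U]) simp_all
qed

sublocale field_derivation "ring_of K" "\<lambda>x. fn K FDelta [x]"
  using open_theory_K K fn_closed[of FDelta]
  by (intro field_derivation_ring_of) (auto simp: models_T_delta_star_def models_T_delta_def)

lemma constant_field_eq: "constant_field = constant_elems K"
  by (rule constant_field_ring_of) unfold_locales

lemma subfield_constant_elems: "subfield (constant_elems K) (ring_of K)"
  using subfield_constant_field by (simp add: constant_field_eq)

lemma field_symbol_cases:
  assumes "f \<in> funs L"
  obtains "f = FAdd" | "f = FSub" | "f = FMul" | "f = FInv" | "f = FZero" | "f = FOne"
    | c where "f = FCst c"
  using assms lang unfolding field_language_def by blast

lemma fn_constant_elems: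
  assumes f: "f \<in> funs L" and as: "length as = fsym_ar f" "set as \<subseteq> constant_elems K"
  shows "fn K f as \<in> constant_elems K"
proof -
  note sub = subringE[OF subfieldE(1)[OF subfield_constant_elems]]
  have CK: "constant_elems K \<subseteq> univ K"
    by (auto simp: constant_elems_def)
  have FS: "fn K FSub [x, y] = x \<ominus>\<^bsub>ring_of K\<^esub> y" if "x \<in> univ K" "y \<in> univ K" for x y
    using open_theory_K(1) that by (simp add: field_struct_def)
  have FI: "fn K FInv [x] = (if x = fn K FZero [] then fn K FZero [] else inv\<^bsub>ring_of K\<^esub> x)"
    if "x \<in> univ K" for x
    using open_theory_K(1) that by (simp add: field_struct_def)
  show ?thesis
    using f
  proof (cases rule: field_symbol_cases)
    case 1
    with as obtain x y where "as = [x, y]"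
      by (auto simp: length_Suc_conv numeral_2_eq_2)
    then show ?thesis
      using 1 as sub(7)[of x y] by simp
  next
    case 2
    with as obtain x y where xy: "as = [x, y]" "x \<in> constant_elems K" "y \<in> constant_elems K"
      by (auto simp: length_Suc_conv numeral_2_eq_2)
    then have "x \<ominus>\<^bsub>ring_of K\<^esub> y \<in> constant_elems K"
      using sub(7)[OF xy(2) sub(5)[OF xy(3)]] by (simp add: a_minus_def)
    then show ?thesis
      using 2 xy FS[of x y] subsetD[OF CK xy(2)] subsetD[OF CK xy(3)] by simp
  next
    case 3
    with as obtain x y where "as = [x, y]"
      by (auto simp: length_Suc_conv numeral_2_eq_2)
    then show ?thesis
      using 3 as sub(6)[of x y] by simp
  next
    case 4
    with as obtain x where x: "as = [x]" "x \<in> constant_elems K"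
      by (auto simp: length_Suc_conv)
    \<comment> \<open>At zero \<open>FInv\<close> has the default value zero, which is a constant as
      well.\<close>
    then have "inv\<^bsub>ring_of K\<^esub> x \<in> constant_elems K" if "x \<noteq> fn K FZero []"
      using that subfield_m_inv(1)[OF subfield_constant_elems, of x] by simp
    then show ?thesis
      using 4 x FI[OF subsetD[OF CK x(2)]] sub(2) by simp
  next
    case 5
    then show ?thesis
      using as sub(2) by simp
  next
    case 6
    then show ?thesis
      using as sub(3) by simp
  next
    case (7 c)
    then have "fn K f as \<in> const_values L K"
      using f as by (auto simp: const_values_def)
    then show ?thesis
      using const_values by blast
  qed
qed

lemma acl_constant_elems: "acl L K (constant_elems K) = constant_elems K"
proof -
  let ?C = "constant_elems K"
  have CK: "?C \<subseteq> univ K"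
    by (auto simp: constant_elems_def)
  \<comment> \<open>The named elements are already constants, so adjoining them does not enlarge the
    field.\<close>
  have gen: "generate_field (ring_of K) (?C \<union> const_values L K) = ?C"
    using const_values CK subfield_constant_elems
    by (intro generate_fieldI[symmetric]) auto
  have "acl L K ?C = {a \<in> univ K.
      (algebraic over generate_field (ring_of K) (?C \<union> const_values L K)) a}"
    using acl_T models_T CK unfolding acl_is_algebraic_closure_def by blast
  then have "acl L K ?C = {a \<in> univ K. (algebraic over ?C) a}"
    unfolding gen .
  also have "\<dots> = ?C"
  proof (intro equalityI subsetI)
    fix a assume "a \<in> {a \<in> univ K. (algebraic over ?C) a}"
    then show "a \<in> ?C"
      using algebraic_over_constant_field[of a] open_theory_K(2)
      by (simp add: constant_field_eq char_zero_def)
  next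
    fix a assume "a \<in> ?C"
    then show "a \<in> {a \<in> univ K. (algebraic over ?C) a}"
      using CK algebraic_self[OF subfieldE(1)[OF subfield_constant_elems]] by auto
  qed
  finally show ?thesis .
qed

section \<open>Topological density of the constants in one field\<close>

lemma openin_def_top:
  "openin (def_top \<chi> K) U \<longleftrightarrow>
    U \<subseteq> univ K \<and> (\<forall>a \<in> U. \<exists>V \<in> chi_basis \<chi> K. (\<lambda>y. fn K FAdd [a, y]) ` V \<subseteq> U)"
  unfolding def_top_def
  by (rule openin_translation_topology) (rule zero_basis_filter_base[OF open_theory_K(3)])

lemma topspace_def_top: "topspace (def_top \<chi> K) = univ K"
  using open_theory_K(4) by (simp add: field_topology_def)

text \<open>Density of the constants is the instance \<open>q = \<delta>(y)\<close> of the scheme (DL).\<close>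

lemma constant_in_open:
  assumes "openin (def_top \<chi> K) U" and "r \<in> U"
  shows "\<exists>c \<in> constant_elems K. c \<in> U"
proof -
  have r: "r \<in> univ K"
    using assms openin_subset topspace_def_top by blast
  \<comment> \<open>For \<open>q = \<delta>(y)\<close> the ordinary polynomial is the variable with
    index 1. It vanishes at \<open>(r, 0)\<close>, and \<open>W\<close> restricts only the
    coordinate with index 0.\<close>
  define a where "a = (\<lambda>i \<in> {..<Suc 1}. if i = 0 then r else fn K FZero [])"
  define W where "W = {x \<in> topspace (def_top_power \<chi> K (Suc 1)). x 0 \<in> U}"
  have W: "openin (def_top_power \<chi> K (Suc 1)) W"
    unfolding W_def using assms(1)
    by (intro openin_continuous_map_preimage[OF continuous_map_product_projection]) auto
  have zero: "fn K FZero [] \<in> univ K"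
    using zero_closed by simp
  have a: "a \<in> {..<Suc 1} \<rightarrow>\<^sub>E univ K"
    using r zero by (auto simp: a_def)
  have "a \<in> W"
    using a assms(2) by (simp add: W_def topspace_def_top a_def)
  have N: "indexed_var 1 \<in> indexed_pset {..<Suc 1} (univ K)"
    unfolding indexed_var_def using one_closed
    by (intro indexed_pset.indexed_pmult indexed_pset.indexed_const) auto
  have eval_X: "mpeval (ring_of K) (indexed_var 1) x = x 1" if "x \<in> {..<Suc 1} \<rightarrow>\<^sub>E univ K" for x
    using that mpeval_indexed_var[OF cring_axioms, of x 1] by auto
  have sep: "mpeval (ring_of K) (mpderiv (ring_of K) 1 (indexed_var 1)) a \<noteq> fn K FZero []"
    using mpderiv_indexed_var[OF cring_axioms] mpeval_indexed_const[OF cring_axioms one_closed] one_not_zero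
    by simp
  have DL: "scheme_DL \<chi> K"
    using K by (simp add: models_T_delta_star_def)
  obtain b where b: "b \<in> univ K" "mpeval (ring_of K) (indexed_var 1) (jet K (Suc 1) b) = fn K FZero []"
    "jet K (Suc 1) b \<in> W"
    using DL[unfolded scheme_DL_def, rule_format, OF order_refl N indexed_var_not_index_free a, of W W]
      W \<open>a \<in> W\<close> sep eval_X[OF a] by (auto simp: a_def)
  have jet: "jet K (Suc 1) b \<in> {..<Suc 1} \<rightarrow>\<^sub>E univ K"
    using b(3) by (simp add: W_def topspace_def_top)
  have "fn K FDelta [b] = fn K FZero []"
    using b(2) eval_X[OF jet] by (simp add: jet_def)
  moreover have "b \<in> U"
    using b(3) by (simp add: W_def jet_def)
  ultimately show ?thesis
    using b(1) by (auto simp: constant_elems_def)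
qed

text \<open>\<open>V\<close> is merely a neighbourhood of 0, so an open subset of it is translated;
  the translate is open by associativity of addition.\<close>

lemma constant_in_translate:
  assumes V: "V \<in> chi_basis \<chi> K" and r: "r \<in> univ K"
  shows "\<exists>c \<in> constant_elems K. \<exists>v \<in> V. c = fn K FAdd [r, v]"
proof -
  obtain U where U: "openin (def_top \<chi> K) U" "fn K FZero [] \<in> U" "U \<subseteq> V"
    using open_theory_K(3) V unfolding zero_basis_def by meson
  define U' where "U' = (\<lambda>y. fn K FAdd [r, y]) ` U"
  have UK: "U \<subseteq> univ K"
    using U(1) by (simp add: openin_def_top)
  have "openin (def_top \<chi> K) U'"
    unfolding openin_def_top
  proof (intro conjI ballI)
    show "U' \<subseteq> univ K"
      using UK r a_closed by (auto simp: U'_def)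
    fix a assume "a \<in> U'"
    then obtain u where u: "u \<in> U" "a = fn K FAdd [r, u]"
      by (auto simp: U'_def)
    then obtain N where N: "N \<in> chi_basis \<chi> K" "(\<lambda>y. fn K FAdd [u, y]) ` N \<subseteq> U"
      using U(1) unfolding openin_def_top by meson
    have XK: "N \<subseteq> univ K"
      using N(1) by (auto simp: chi_basis_def chi_set_def)
    have "fn K FAdd [a, y] = fn K FAdd [r, fn K FAdd [u, y]]" if "y \<in> N" for y
      using a_assoc[of r u y] r u UK XK that by auto
    then have "(\<lambda>y. fn K FAdd [a, y]) ` N \<subseteq> U'"
      using N(2) by (auto simp: U'_def)
    then show "\<exists>N \<in> chi_basis \<chi> K. (\<lambda>y. fn K FAdd [a, y]) ` N \<subseteq> U'"
      using N(1) by blast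
  qed
  moreover have "fn K FAdd [r, fn K FZero []] \<in> U'"
    using U(2) by (simp add: U'_def)
  ultimately obtain c where "c \<in> constant_elems K" "c \<in> U'"
    using constant_in_open by meson
  then show ?thesis
    using U(3) by (auto simp: U'_def)
qed

text \<open>A polynomial in one variable with infinitely many zeros vanishes as a function, so the
  equations in \<open>F\<close> impose nothing.\<close>

lemma infinite_zariski_closed:
  assumes "zariski_closed K 1 Z" and "infinite Z"
  shows "Z = {..<1} \<rightarrow>\<^sub>E univ K"
proof -
  obtain F where F: "F \<subseteq> indexed_pset {..<1} (univ K)"
    and Z: "Z = {x \<in> {..<1} \<rightarrow>\<^sub>E univ K. \<forall>P \<in> F. mpeval (ring_of K) P x = fn K FZero []}"
    using assms(1) unfolding zariski_closed_def by auto
  have one: "{..<1} = {0 :: nat}"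
    by auto
  have "mpeval (ring_of K) P y = fn K FZero []" if "P \<in> F" "y \<in> {..<1} \<rightarrow>\<^sub>E univ K" for P y
  proof (rule ccontr)
    assume "mpeval (ring_of K) P y \<noteq> fn K FZero []"
    moreover have "P \<in> indexed_pset {0} (carrier (ring_of K))" "y 0 \<in> univ K"
      using F that unfolding one by auto
    ultimately have "finite {a \<in> univ K. \<exists>x. x 0 = a \<and> mpeval (ring_of K) P x = fn K FZero []}"
      using indexed_pset_single_finite_zeros[OF domain_axioms, of P 0 y] by simp
    moreover have "(\<lambda>x. x 0) ` Z \<subseteq> {a \<in> univ K. \<exists>x. x 0 = a \<and> mpeval (ring_of K) P x = fn K FZero []}"
      using that(1) by (auto simp: Z)
    ultimately have "finite ((\<lambda>x. x 0) ` Z)"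
      by (rule rev_finite_subset)
    \<comment> \<open>Points of the first power are functions on \<open>{..<1}\<close>, determined
      by their value at 0.\<close>
    moreover have "inj_on (\<lambda>x. x 0) Z"
    proof (rule inj_onI)
      fix x y assume "x \<in> Z" "y \<in> Z" "x 0 = y 0"
      then show "x = y"
        unfolding Z one by (intro PiE_ext[of x "{0}" _ y]) auto
    qed
    ultimately show False
      using assms(2) finite_imageD by blast
  qed
  then show ?thesis
    by (auto simp: Z)
qed

text \<open>A definable set in one variable is finite, and then algebraic over its parameters, or has
  interior, and then meets the dense set of constants.\<close>

lemma tarski_vaught_constant_elems: "tarski_vaught L K (constant_elems K)"
  unfolding tarski_vaught_def
proof (intro conjI ballI allI impI)
  show CK: "constant_elems K \<subseteq> univ K"
    by (auto simp: constant_elems_def)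
  fix \<phi> s n a
  assume \<phi>: "\<phi> \<in> formulas L" and s: "s \<in> assigns (constant_elems K)"
    and a: "a \<in> univ K" and sat: "sat K (s(n := a)) \<phi>"
  \<comment> \<open>The transposition of 0 and \<open>n\<close> moves the quantified variable to
    position 0.\<close>
  define \<pi> :: "nat \<Rightarrow> nat" where "\<pi> = id(0 := n, n := 0)"
  define \<psi> where "\<psi> = rename \<pi> \<phi>"
  define t where "t = s \<circ> \<pi>"
  have \<psi>: "\<psi> \<in> formulas L"
    using \<phi> by (simp add: \<psi>_def rename_formulas)
  have t: "t \<in> assigns (constant_elems K)"
    using s by (simp add: t_def assigns_def)
  have "inj \<pi>"
    by (auto simp: \<pi>_def inj_def)
  then have sat_\<psi>: "sat K (t(0 := c)) \<psi> \<longleftrightarrow> sat K (s(n := c)) \<phi>" for c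
    unfolding \<psi>_def
    by (subst sat_rename) (auto simp: t_def \<pi>_def fun_eq_iff intro!: arg_cong[of _ _ "\<lambda>s. sat K s \<phi>"])
  define S where "S = {c \<in> univ K. sat K (t(0 := c)) \<psi>}"
  have "\<exists>c \<in> constant_elems K. sat K (t(0 := c)) \<psi>"
  proof (cases "finite S")
    case True
    have "t \<in> assigns (univ K)"
      using t CK by (rule assigns_mono)
    moreover have "t i \<in> constant_elems K" for i
      using t by (simp add: assigns_def)
    \<comment> \<open>The given \<open>a\<close> lies in the finite set, so it is algebraic over
      constants and is its own witness.\<close>
    ultimately have "a \<in> acl L K (constant_elems K)"
      using True \<psi> a sat unfolding acl_def S_def
      by (intro CollectI conjI bexI[of _ \<psi>] bexI[of _ t]) (simp_all add: sat_\<psi>)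
    then show ?thesis
      using sat by (auto simp: acl_constant_elems sat_\<psi>)
  next
    case False
    define S1 where "S1 = {x \<in> {..<1} \<rightarrow>\<^sub>E univ K. sat K (\<lambda>i. if i < 1 then x i else t i) \<psi>}"
    have S1_iff: "x \<in> S1 \<longleftrightarrow> x \<in> {..<1} \<rightarrow>\<^sub>E univ K \<and> sat K (t(0 := x 0)) \<psi>" for x
    proof -
      have "(\<lambda>i. if i < 1 then x i else t i) = t(0 := x 0)"
        by auto
      then show ?thesis
        by (simp add: S1_def del: One_nat_def)
    qed
    have "S1 \<in> definable_sets L K 1"
      unfolding definable_sets_def S1_def using \<psi> assigns_mono[OF t CK] by blast
    then obtain m :: nat and Z U where Z: "\<And>i. i < m \<Longrightarrow> zariski_closed K 1 (Z i)"
      and U: "\<And>i. i < m \<Longrightarrow> openin (def_top_power \<chi> K 1) (U i)"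
      and S1: "S1 = (\<Union>i < m. Z i \<inter> U i)"
      by (rule definable_decomposition) (rule that)
    have "S \<subseteq> (\<lambda>x. x 0) ` S1"
    proof
      fix c assume "c \<in> S"
      then show "c \<in> (\<lambda>x. x 0) ` S1"
        by (intro image_eqI[of _ _ "\<lambda>i \<in> {..<1}. c"]) (auto simp: S1_iff S_def)
    qed
    then have "infinite S1"
      using False finite_surj by blast
    \<comment> \<open>Some piece is infinite. Its Zariski closed part is then the whole line, so its
      open part lies entirely in \<open>S1\<close>.\<close>
    then obtain i where i: "i < m" "infinite (Z i \<inter> U i)"
      unfolding S1 by auto
    then have "Z i = {..<1} \<rightarrow>\<^sub>E univ K"
      using infinite_zariski_closed[OF Z[OF i(1)]] by blast
    moreover have "U i \<subseteq> {..<1} \<rightarrow>\<^sub>E univ K"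
      using openin_subset[OF U[OF i(1)]] by (simp add: topspace_def_top)
    ultimately have "U i \<subseteq> S1"
      using i(1) by (auto simp: S1)
    \<comment> \<open>Projections are open maps, which identifies open sets of the first power with
      open sets of the field.\<close>
    have "openin (def_top \<chi> K) ((\<lambda>x. x 0) ` U i)"
      using open_map_product_projection[of "0 :: nat" "{..<1}" "\<lambda>_. def_top \<chi> K"] U[OF i(1)]
      unfolding open_map_def by (simp del: One_nat_def)
    moreover obtain x where "x \<in> U i"
      using i(2) by fastforce
    ultimately obtain c where c: "c \<in> constant_elems K" "c \<in> (\<lambda>x. x 0) ` U i"
      using constant_in_open by blast
    then have "sat K (t(0 := c)) \<psi>"
      using \<open>U i \<subseteq> S1\<close> S1_iff by auto
    then show ?thesis
      using c(1) by blast
  qed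
  then show "\<exists>c \<in> constant_elems K. sat K (s(n := c)) \<phi>"
    by (simp add: sat_\<psi>)
qed

lemma elementary_constant_elems:
  "elementary_substructure L (K\<lparr>univ := constant_elems K\<rparr>) K"
proof (rule tarski_vaught_elementary_substructure[OF _ _ tarski_vaught_constant_elems])
  show "is_struct L K"
    using models_T by (simp add: models_def)
  show "is_struct L (K\<lparr>univ := constant_elems K\<rparr>)"
    using subringE(4)[OF subfieldE(1)[OF subfield_constant_elems]] fn_constant_elems lang
    by (simp add: is_struct_def field_language_def)
qed

end


section \<open>The constants of a Boolean product\<close>

locale generic_product =
  fixes L :: "('c fsym, 'r) lang" and \<chi> :: "('c fsym, 'r) fm" and T :: "('c fsym, 'r) fm set"
    and P :: "('x, 'a, 'c fsym, 'r) bprod"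
  assumes lang: "field_language L"
    and open_T: "open_theory TYPE('a) L \<chi> T"
    and acl_T: "acl_is_algebraic_closure TYPE('a) L T"
    and Gamma_delta: "Gamma_e (lang_delta L) (models_T_delta_star L \<chi> T) P"
    and const_values: "const_values L (prod_of P) \<subseteq> constants P"
begin

lemma lang_delta_formulas: "formulas L \<subseteq> formulas (lang_delta L)"
proof -
  have "tm_in L t \<Longrightarrow> tm_in (lang_delta L) t" for t
    by (induction t) (auto simp: lang_delta_def)
  then have "fm_in L \<phi> \<Longrightarrow> fm_in (lang_delta L) \<phi>" for \<phi>
    by (induction \<phi>) (auto simp: lang_delta_def)
  then show ?thesis
    by (auto simp: formulas_def)
qed

text \<open>A reduct keeps its elements and its patchwork, and fewer truth sets have to be
  clopen.\<close>

lemma Gamma_T: "Gamma_e L (models L T) P"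
proof -
  have "truth_sets L P \<subseteq> truth_sets (lang_delta L) P"
    using lang_delta_formulas unfolding truth_sets_def by blast
  moreover have "is_struct (lang_delta L) M \<Longrightarrow> is_struct L M" for M :: "('x \<Rightarrow> 'a, 'c fsym, 'r) struct"
    by (auto simp: is_struct_def lang_delta_def)
  ultimately show ?thesis
    using Gamma_delta
    by (auto simp: Gamma_e_def subdirect_product_def models_T_delta_star_def models_T_delta_def)
qed

sublocale boolean_product L "models L T" P
  using Gamma_T by unfold_locales

lemma constants_iff:
  "a \<in> constants P \<longleftrightarrow> a \<in> elems P \<and> (\<forall>x \<in> points P. a x \<in> constant_elems (fiber P x))"
proof -
  have "fn (prod_of P) FDelta [a] = fn (prod_of P) FZero [] \<longleftrightarrow>
      (\<forall>x \<in> points P. fn (fiber P x) FDelta [a x] = fn (fiber P x) FZero [])"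
    by (auto simp: fun_eq_iff restrict_def)
  then show ?thesis
    using elems_at by (auto simp: constants_def constant_elems_def)
qed

lemma generic_field_fiber:
  assumes "x \<in> points P"
  shows "generic_field L \<chi> T (fiber P x)"
proof
  show "models_T_delta_star L \<chi> T (fiber P x)"
    using Gamma_delta assms by (simp add: Gamma_e_def)
  show "const_values L (fiber P x) \<subseteq> constant_elems (fiber P x)"
  proof
    fix k assume "k \<in> const_values L (fiber P x)"
    then obtain c where c: "FCst c \<in> funs L" "k = fn (fiber P x) (FCst c) []"
      by (auto simp: const_values_def)
    then have "fn (prod_of P) (FCst c) [] \<in> constants P"
      using const_values by (auto simp: const_values_def simp del: prod_of_sel)
    then show "k \<in> constant_elems (fiber P x)"
      using assms c(2) by (auto simp: constants_iff)
  qed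
qed (rule lang open_T acl_T)+

lemma fn_constants:
  assumes "f \<in> funs L" and "length as = fun_ar L f" and "set as \<subseteq> constants P"
  shows "fn (prod_of P) f as \<in> constants P"
  unfolding constants_iff
proof (intro conjI ballI)
  have "set as \<subseteq> elems P"
    using assms(3) by (auto simp: constants_def)
  then show "fn (prod_of P) f as \<in> elems P"
    using is_struct_prod assms(1,2) by (simp add: is_struct_def)
  fix x assume x: "x \<in> points P"
  have "fn (fiber P x) f (map (\<lambda>a. a x) as) \<in> constant_elems (fiber P x)"
    using assms x lang
    by (intro generic_field.fn_constant_elems[OF generic_field_fiber])
      (auto simp: constants_iff field_language_def)
  then show "fn (prod_of P) f as x \<in> constant_elems (fiber P x)"
    using x by simp
qed

lemma zero_one_constants:
  "fn (prod_of P) FZero [] \<in> constants P" "fn (prod_of P) FOne [] \<in> constants P"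
  using lang by (auto intro!: fn_constants simp: field_language_def simp del: prod_of_sel)

lemma constants_sub: "constants P \<subseteq> elems P"
  by (auto simp: constants_def)

text \<open>Being constant is a condition at each point, so it survives patching.\<close>

lemma patches_constants: "patches (base P) (constants P)"
  unfolding patches_def
proof (intro ballI)
  fix f g U assume fg: "f \<in> constants P" "g \<in> constants P" and U: "U \<in> clopens (base P)"
  obtain h where h: "h \<in> elems P" "\<forall>x \<in> U. f x = h x" "\<forall>x \<in> points P - U. g x = h x"
    using patches_elems[unfolded patches_def, rule_format, OF _ _ U] fg constants_sub by blast
  have "h x \<in> constant_elems (fiber P x)" if "x \<in> points P" for x
    using that fg h by (cases "x \<in> U") (auto simp: constants_iff dest: bspec)
  then show "\<exists>h \<in> constants P. (\<forall>x \<in> U. f x = h x) \<and> (\<forall>x \<in> points P - U. g x = h x)"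
    using h by (intro bexI[of _ h]) (simp_all add: constants_iff)
qed

text \<open>An arbitrary lift of a constant of the fibre need not be constant elsewhere. The locus
  \<open>\<delta>(a) = 0\<close> is clopen, as the truth set of a formula with
  \<open>FDelta\<close>, so the lift is replaced by 0 off it.\<close>

lemma constants_at:
  assumes x: "x \<in> points P"
  shows "(\<lambda>d. d x) ` constants P = constant_elems (fiber P x)"
proof (intro equalityI subsetI)
  fix c assume c: "c \<in> constant_elems (fiber P x)"
  then obtain a where a: "a \<in> elems P" "a x = c"
    using elems_lift[OF x, of c] by (auto simp: constant_elems_def)
  define U where "U = truth_set P (Eq (Fn FDelta [Var 0]) (Fn FZero [])) (\<lambda>_. a)"
  have U_iff: "y \<in> U \<longleftrightarrow> y \<in> points P \<and> fn (fiber P y) FDelta [a y] = fn (fiber P y) FZero []" for y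
    by (simp add: U_def truth_set_def)
  have "U \<in> clopens (base P)"
  proof -
    have "Eq (Fn FDelta [Var 0]) (Fn FZero []) \<in> formulas (lang_delta L)"
      using lang by (simp add: formulas_def lang_delta_def field_language_def)
    then have "U \<in> truth_sets (lang_delta L) P"
      using a(1) unfolding U_def truth_sets_def by (auto simp: assigns_def)
    then show ?thesis
      using Gamma_delta by (auto simp: Gamma_e_def)
  qed
  then obtain h where h: "h \<in> elems P" "\<forall>y \<in> U. a y = h y"
    "\<forall>y \<in> points P - U. fn (prod_of P) FZero [] y = h y"
    using patches_elems[unfolded patches_def, rule_format, OF a(1), of "fn (prod_of P) FZero []" U]
      zero_one_constants(1) constants_sub by blast
  have "h y \<in> constant_elems (fiber P y)" if y: "y \<in> points P" for y
  proof (cases "y \<in> U")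
    case True
    then have "h y = a y"
      using h(2) by simp
    then show ?thesis
      using True elems_at[OF a(1) y] by (simp add: constant_elems_def U_iff)
  next
    case False
    then have "h y = fn (prod_of P) FZero [] y"
      using h(3) y by (simp del: prod_of_sel)
    then show ?thesis
      using zero_one_constants(1) y by (simp add: constants_iff del: prod_of_sel)
  qed
  then have "h \<in> constants P"
    using h(1) by (simp add: constants_iff)
  moreover have "x \<in> U"
    using c a(2) x by (simp add: U_iff constant_elems_def)
  then have "h x = c"
    using h(2) a(2) by auto
  ultimately show "c \<in> (\<lambda>d. d x) ` constants P"
    by blast
qed (use x in \<open>auto simp: constants_iff\<close>)

lemma tarski_vaught_fiber:
  "x \<in> points P \<Longrightarrow> tarski_vaught L (fiber P x) ((\<lambda>d. d x) ` constants P)"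
  using generic_field.tarski_vaught_constant_elems[OF generic_field_fiber] by (simp add: constants_at)

lemma is_struct_constants: "is_struct L ((prod_of P)\<lparr>univ := constants P\<rparr>)"
  using fn_constants zero_one_constants(1) unfolding is_struct_def by (auto simp del: prod_of_sel)

lemma elementary_constants:
  "elementary_substructure L ((prod_of P)\<lparr>univ := constants P\<rparr>) (prod_of P)"
proof (rule tarski_vaught_elementary_substructure[OF is_struct_prod is_struct_constants])
  show "tarski_vaught L (prod_of P) (constants P)"
    using constants_sub zero_one_constants(1) patches_constants tarski_vaught_fiber
    by (intro tarski_vaught_prod) auto
qed

text \<open>Every clopen set is the set of points where some constant takes the value 1.\<close>

lemma truth_sets_constants: "truth_sets L (sub_bprod P (constants P)) = clopens (base P)"
proof (intro equalityI subsetI)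
  fix U assume "U \<in> truth_sets L (sub_bprod P (constants P))"
  then obtain \<phi> s where \<phi>: "\<phi> \<in> formulas L" "s \<in> assigns (constants P)"
    "U = truth_set (sub_bprod P (constants P)) \<phi> s"
    by (auto simp: truth_sets_def sub_bprod_def)
  then show "U \<in> clopens (base P)"
    using truth_set_sub_bprod[OF tarski_vaught_fiber] truth_set_clopen
      assigns_mono[OF _ constants_sub] by simp
next
  fix U assume U: "U \<in> clopens (base P)"
  obtain h where h: "h \<in> constants P" "\<forall>x \<in> U. fn (prod_of P) FOne [] x = h x"
    "\<forall>x \<in> points P - U. fn (prod_of P) FZero [] x = h x"
    using patches_constants[unfolded patches_def, rule_format, OF zero_one_constants(2,1) U] by blast
  define \<phi> :: "('c fsym, 'r) fm" where "\<phi> = Eq (Var 0) (Fn FOne [])"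
  have \<phi>: "\<phi> \<in> formulas L"
    using lang by (simp add: \<phi>_def formulas_def field_language_def)
  have s: "(\<lambda>_. h) \<in> assigns (constants P)"
    using h(1) by (simp add: assigns_def)
  have UP: "U \<subseteq> points P"
    using U by (simp add: clopens_def openin_subset)
  \<comment> \<open>Since 0 and 1 differ in every fibre, \<open>h\<close> takes the value 1 exactly
    on \<open>U\<close>.\<close>
  have one: "fn (fiber P x) FOne [] \<noteq> fn (fiber P x) FZero []" if x: "x \<in> points P" for x
  proof -
    interpret generic_field L \<chi> T "fiber P x"
      by (rule generic_field_fiber[OF x])
    show ?thesis
      using one_not_zero by simp
  qed
  have "h x = fn (fiber P x) FOne [] \<longleftrightarrow> x \<in> U" if x: "x \<in> points P" for x
    using x h(2,3) one[OF x] by (cases "x \<in> U") (auto dest!: bspec)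
  then have "truth_set P \<phi> (\<lambda>_. h) = U"
    using UP by (auto simp: truth_set_def \<phi>_def)
  then have "truth_set (sub_bprod P (constants P)) \<phi> (\<lambda>_. h) = U"
    using truth_set_sub_bprod[OF tarski_vaught_fiber \<phi> s] by simp
  then show "U \<in> truth_sets L (sub_bprod P (constants P))"
    using \<phi> s unfolding truth_sets_def by (auto simp: sub_bprod_def)
qed

text \<open>In each fibre some constant differs from \<open>r\<close> by an element of the basic
  neighbourhood; that this holds nearby is a truth set, so the constants can be glued.\<close>

lemma constants_dense:
  assumes \<chi>: "\<chi> \<in> formulas L" and r: "r \<in> elems P" and s: "s \<in> assigns (elems P)"
    and \<chi>_zero: "truth_set P \<chi> (s(0 := fn (prod_of P) FZero [])) = points P"
  shows "\<exists>v \<in> elems P. truth_set P \<chi> (s(0 := v)) = points P \<and> fn (prod_of P) FAdd [r, v] \<in> constants P"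
proof -
  \<comment> \<open>The difference \<open>c - r(x)\<close> satisfies \<open>\<chi>\<close>. Writing
    the condition in terms of \<open>c\<close> lets the glued objects be constants.\<close>
  define Q where "Q x c \<longleftrightarrow> sat (fiber P x) ((\<lambda>i. s i x)(0 := fn (fiber P x) FSub [c, r x])) \<chi>" for x c
  have diff: "fn (prod_of P) FSub [d, r] \<in> elems P" if "d \<in> constants P" for d
    using that constants_sub r lang is_struct_prod
    by (auto simp: is_struct_def field_language_def simp del: prod_of_sel(2))
  have Q_iff: "truth_set P \<chi> (s(0 := fn (prod_of P) FSub [d, r])) = {x \<in> points P. Q x (d x)}" for d
    unfolding truth_set_def fun_upd_at Q_def by auto
  have "\<exists>d \<in> constants P. \<forall>x \<in> points P. Q x (d x)"
  proof (rule patches_glue[OF compact_base patches_constants])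
    show "constants P \<noteq> {}"
      using zero_one_constants(1) by blast
    fix x assume x: "x \<in> points P"
    interpret generic_field L \<chi> T "fiber P x"
      by (rule generic_field_fiber[OF x])
    define t where "t = (\<lambda>i. s i x)"
    have t: "t \<in> assigns (univ (fiber P x))"
      using s elems_at[OF _ x] by (simp add: t_def assigns_def)
    have "x \<in> truth_set P \<chi> (s(0 := fn (prod_of P) FZero []))"
      using \<chi>_zero x by simp
    then have "sat (fiber P x) (t(0 := fn (fiber P x) FZero [])) \<chi>"
      using x unfolding truth_set_def fun_upd_at t_def by simp
    then have basis: "chi_set \<chi> (fiber P x) t \<in> chi_basis \<chi> (fiber P x)"
      using t zero_closed unfolding chi_basis_def by (auto simp: chi_set_def)
    obtain c v where c: "c \<in> constant_elems (fiber P x)"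
      and v: "v \<in> chi_set \<chi> (fiber P x) t" "c = fn (fiber P x) FAdd [r x, v]"
      using constant_in_translate[OF basis elems_at[OF r x]] by (elim bexE)
    have "c \<in> (\<lambda>d. d x) ` constants P"
      using c by (simp add: constants_at[OF x])
    then obtain d where d: "d \<in> constants P" "d x = c"
      by (elim imageE) simp
    have "v \<in> univ (fiber P x)"
      using v(1) by (simp add: chi_set_def)
    then have "fn (fiber P x) FSub [c, r x] = v"
      using open_theory_K(1) v(2) elems_at[OF r x] a_closed[of "r x" v]
        add.inv_solve_right'[of v c "r x"] a_comm[of "r x" v]
      by (simp add: field_struct_def a_minus_def)
    then have "Q x (d x)"
      using v(1) by (simp add: Q_def d(2) chi_set_def t_def)
    moreover have "{x \<in> points P. Q x (d x)} \<in> clopens (base P)"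
      using truth_set_clopen[OF \<chi> assigns_upd[OF s diff[OF d(1)], of 0]] by (simp only: Q_iff)
    ultimately show "\<exists>e \<in> constants P. \<exists>V \<in> clopens (base P). x \<in> V \<and> (\<forall>y \<in> V. Q y (e y))"
      using d(1) x by (intro bexI[of _ d] bexI[of _ "{x \<in> points P. Q x (d x)}"]) auto
  qed
  then obtain d where d: "d \<in> constants P" "\<forall>x \<in> points P. Q x (d x)"
    by blast
  define v where "v = fn (prod_of P) FSub [d, r]"
  \<comment> \<open>This is equality of functions, so values off the base count; both sides are
    \<open>undefined\<close> there.\<close>
  have "fn (prod_of P) FAdd [r, v] x = d x" for x
  proof (cases "x \<in> points P")
    case x: True
    interpret generic_field L \<chi> T "fiber P x"
      by (rule generic_field_fiber[OF x])
    have dr: "d x \<in> univ (fiber P x)" "r x \<in> univ (fiber P x)"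
      using d(1) constants_sub r elems_at[OF _ x] by auto
    then have "r x \<oplus>\<^bsub>ring_of (fiber P x)\<^esub> (d x \<ominus>\<^bsub>ring_of (fiber P x)\<^esub> r x) = d x"
      using add.m_lcomm[of "r x" "d x" "\<ominus>\<^bsub>ring_of (fiber P x)\<^esub> r x"] r_neg[of "r x"] r_zero[of "d x"]
        a_inv_closed[of "r x"]
      by (simp add: a_minus_def)
    then show ?thesis
      using open_theory_K(1) dr x by (simp add: v_def field_struct_def)
  next
    case False
    then show ?thesis
      using d(1) constants_sub elems_extensional[of d] by (auto simp: extensional_def)
  qed
  then have "fn (prod_of P) FAdd [r, v] \<in> constants P"
    using d(1) by presburger
  moreover have "truth_set P \<chi> (s(0 := v)) = points P"
    using d(2) by (auto simp: v_def Q_iff simp del: prod_of_sel)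
  ultimately show ?thesis
    using diff[OF d(1)] unfolding v_def by blast
qed

end

theorem proposition6p9:
  fixes L :: "('c fsym, 'r) lang"
    and T :: "('c fsym, 'r) fm set"
    and \<chi> \<chi>p :: "('c fsym, 'r) fm"
    and \<T> :: "(ba_sym, unit) fm set"
    and P :: "('x, 'a, 'c fsym, 'r) bprod"
  assumes "infinite (UNIV :: 'a set)"
    and "funs L \<lesssim> (UNIV :: 'a set)" and "rels L \<lesssim> (UNIV :: 'a set)"
    and "field_language L"
    and "open_theory TYPE('a) L \<chi> T"
    and "acl_is_algebraic_closure TYPE('a) L T"
    and "dagger TYPE('a) L T"
    and "dagger_large TYPE('a) L \<chi> T"
    and "quantifier_elimination TYPE('a) L T"
    and "chi_p_formula TYPE('x) TYPE('a) L T \<chi> \<chi>p"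
    and "complete_ba_theory \<T>"
    and "Gamma_e_ba (lang_delta L) \<T> (models_T_delta_star L \<chi> T) P"
    and "const_values L (prod_of P) \<subseteq> constants P"
  shows "dense_pair L T \<chi>p \<T> P (constants P) \<and>
         elementary_substructure L ((prod_of P)\<lparr>univ := constants P\<rparr>) (prod_of P)"
proof -
  interpret generic_product L \<chi> T P
    using assms by unfold_locales (simp_all add: Gamma_e_ba_def)
  let ?D = "constants P"
  have ba: "models ba_lang \<T> (set_algebra (points P) (clopens (base P)))"
    using assms(12) by (simp add: Gamma_e_ba_def)
  have T: "T \<subseteq> formulas L" and \<chi>: "\<chi> \<in> formulas L"
    using open_T by (auto simp: open_theory_def complete_theory_def sentences_def)
  \<comment> \<open>The basic neighbourhoods in the product consist of the elements satisfying
    \<open>\<chi>\<close> at every point.\<close>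
  have \<chi>p: "chi_set \<chi>p (prod_of (bprod_p P)) s =
      {v \<in> elems P. truth_set P \<chi> (s(0 := v)) = points P}" if "s \<in> assigns (elems P)" for s
  proof -
    have "sat (prod_of (bprod_p P)) (s(0 := v)) \<chi>p \<longleftrightarrow> truth_set P \<chi> (s(0 := v)) = points P"
      if v: "v \<in> elems P" for v
      using assms(10) Gamma_T assigns_upd[OF \<open>s \<in> assigns (elems P)\<close> v]
      unfolding chi_p_formula_def by blast
    then show ?thesis
      by (auto simp: chi_set_def bprod_p_def)
  qed
  have fiber: "fiber (sub_bprod P ?D) x = (fiber P x)\<lparr>univ := constant_elems (fiber P x)\<rparr>"
    if "x \<in> points P" for x
    using constants_at[OF that] by (simp add: sub_bprod_def)
  \<comment> \<open>As the Boolean algebra of the constants is the full clopen algebra, (D1) becomes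
    reflexivity and in (D4) \<open>e\<close> itself is the smaller set.\<close>
  have "dense_pair L T \<chi>p \<T> P ?D"
    unfolding dense_pair_def truth_sets_constants
  proof (intro conjI ballI impI)
    show "Gamma_e_ba L \<T> (models L T) P"
      using Gamma_T ba by (simp add: Gamma_e_ba_def)
    show "substructure L ((prod_of P)\<lparr>univ := ?D\<rparr>) (prod_of P)"
      using elementary_constants by (simp add: elementary_substructure_def)
    show "models L T (fiber (sub_bprod P ?D) x)" if x: "x \<in> points P" for x
      unfolding fiber[OF x]
      using generic_field.elementary_constant_elems[OF generic_field_fiber[OF x]] T
        generic_field.models_T[OF generic_field_fiber[OF x]]
      by (rule models_elementary_substructure)
    show "patchwork (sub_bprod P ?D) (clopens (base P))"
      using patchwork_iff_patches[of "sub_bprod P ?D"] patches_constants by (simp add: sub_bprod_def)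
    show "elementary_substructure ba_lang (set_algebra (points P) (clopens (base P)))
        (set_algebra (points P) (clopens (base P)))"
      using ba by (simp add: elementary_substructure_def substructure_def models_def)
    show "acl_closed L (fiber P x) (univ (fiber (sub_bprod P ?D) x))" if x: "x \<in> points P" for x
      using generic_field.acl_constant_elems[OF generic_field_fiber[OF x]]
      by (simp add: acl_closed_def fiber[OF x])
    fix r s assume r: "r \<in> elems P" and s: "s \<in> assigns (elems P)"
      and "fn (prod_of P) FZero [] \<in> chi_set \<chi>p (prod_of (bprod_p P)) s"
    then have "truth_set P \<chi> (s(0 := fn (prod_of P) FZero [])) = points P"
      by (simp add: \<chi>p del: prod_of_sel)
    then show "(\<lambda>y. fn (prod_of P) FAdd [r, y]) ` chi_set \<chi>p (prod_of (bprod_p P)) s \<inter> ?D \<noteq> {}"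
      using constants_dense[OF \<chi> r s] \<chi>p[OF s] by blast
  qed (use ba in auto)
  then show ?thesis
    using elementary_constants by blast
qed

end
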